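(* Let $A$ be an $n\times n$ complex matrix, let $\mathcal{V}\subseteq\mathbb{C}^n$ be a linear subspace with $\dim\mathcal{V}\le 2$, and let $A_{\mathcal{V}}:=P_{\mathcal{V}}A|_{\mathcal{V}}:\mathcal{V}\to\mathcal{V}$ be the compression of $A$ to $\mathcal{V}$, where $P_{\mathcal{V}}$ denotes the orthogonal projection onto $\mathcal{V}$. Then: (a) If $\|\hat f(A)\|=\|\hat f(A_{\mathcal{V}})\|$, where $\hat f$ is an extremal function for $A$, then $A$ satisfies Crouzeix's conjecture. (b) If the cyclic subspace generated by an extremal vector $x$ for $A$ is one or two dimensional, then $A$ satisfies Crouzeix's conjecture. (c) If $A$ is a $3\times 3$ matrix and an extremal vector $x\in\mathbb{C}^3$ is not cyclic for $A$, then $A$ satisfies Crouzeix's conjecture. In particular, every $3\times 3$ non-cyclic matrix satisfies Crouzeix's conjecture.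
   Context: All matrices are square with complex entries, $\|\cdot\|$ is the operator norm induced by the Euclidean norm, and $W(A)=\{\langle Ax,x\rangle:\langle x,x\rangle=1\}$ is the numerical range (for a linear operator on a finite-dimensional inner product space it is defined in the same way). A matrix $A$ "satisfies Crouzeix's conjecture" if $\|p(A)\|\le 2\sup_{z\in W(A)}|p(z)|$ for every complex polynomial $p$. $\mathbf{A}(W(A))$ denotes the algebra of functions that are continuous on $W(A)$ and analytic on the interior of $W(A)$; by Mergelyan's theorem polynomials are uniformly dense in it, and for $f\in\mathbf{A}(W(A))$ and an operator $B$ with $W(B)\subseteq W(A)$ (such as $B=A$ or $B=A_{\mathcal V}$), $f(B)$ is the limit of $p_k(B)$ for polynomials $p_k\to f$ uniformly on $W(A)$. An extremal function for $A$ is a function $\hat f\in\mathbf{A}(W(A))$, not identically zero, which attains the supremum $$\sup_{f\in\mathbf{A}(W(A))}\frac{\|f(A)\|}{\max_{z\in W(A)}|f(z)|}.$$ (It is known that such functions exist.) Given an extremal function $\hat f$ for $A$, a nonzero vector $x$ with $\|\hat f(A)x\|=\|\hat f(A)\|\,\|x\|$ is called a (corresponding) extremal vector for $A$. For $y\in\mathbb{C}^n$ the cyclic subspace generated by $y$ is $\operatorname{span}\{y,Ay,A^2y,\ldots\}$; $y$ is cyclic for $A$ if this subspace is $\mathbb{C}^n$; $A$ is cyclic if some $y\in\mathbb{C}^n$ is cyclic for $A$, and non-cyclic otherwise. *)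

theory Defs
  imports "HOL-Analysis.Analysis" "HOL-Computational_Algebra.Polynomial"
begin

text \<open>
  The library inner product on \<^typ>\<open>complex^'n\<close> is the real one; its norm is the Euclidean norm
  of \<open>\<complex>\<^sup>n\<close>, so \<open>onorm\<close> is the operator norm of a matrix. Complex subspaces, spans and
  dimensions are those of the interpretation \<open>vec\<close> (scalar multiplication \<open>*s\<close>).
\<close>

definition cinner :: "complex^'n \<Rightarrow> complex^'n \<Rightarrow> complex" where
  "cinner x y = (\<Sum>i\<in>UNIV. x $ i * cnj (y $ i))"

definition numerical_range :: "complex^'n^'n \<Rightarrow> complex set" where
  "numerical_range A = {cinner (A *v x) x | x. cinner x x = 1}"

text \<open>
  An operator on a subspace \<open>V\<close> is represented by a function on the whole space of which only
  the values on \<open>V\<close> matter. A matrix is used through \<open>(*v) A\<close>: the power \<open>A ^ i\<close> of the type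
  \<^typ>\<open>complex^'n^'n\<close> is the entrywise one.
\<close>

definition poly_op :: "complex poly \<Rightarrow> (complex^'n \<Rightarrow> complex^'n) \<Rightarrow> complex^'n \<Rightarrow> complex^'n" where
  "poly_op p T x = (\<Sum>i\<le>degree p. coeff p i *s (T ^^ i) x)"

text \<open>For \<open>V = UNIV\<close> this is literally \<open>onorm\<close>; for \<open>V = {0}\<close> it is \<open>0\<close>.\<close>

definition onorm_on :: "(complex^'n) set \<Rightarrow> (complex^'n \<Rightarrow> complex^'n) \<Rightarrow> real" where
  "onorm_on V T = (SUP x\<in>V. norm (T x) / norm x)"

definition satisfies_crouzeix :: "complex^'n^'n \<Rightarrow> bool" where
  "satisfies_crouzeix A \<longleftrightarrow>
     (\<forall>p. onorm (poly_op p ((*v) A)) \<le> 2 * (SUP z\<in>numerical_range A. cmod (poly p z)))"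

definition analytic_algebra :: "complex set \<Rightarrow> (complex \<Rightarrow> complex) set" where
  "analytic_algebra K = {f. continuous_on K f \<and> f analytic_on interior K}"

text \<open>
  \<open>f(T)\<close> for \<open>f\<close> in the algebra over \<open>K\<close>: the limit of \<open>p\<^sub>k(T)\<close> for polynomials \<open>p\<^sub>k\<close> converging
  to \<open>f\<close> uniformly on \<open>K\<close>, taken pointwise on the (finite-dimensional) space on which \<open>T\<close> acts.
  It is meant for \<open>K = W(A)\<close> and operators \<open>T\<close> with \<open>W(T) \<subseteq> K\<close>; the limit then exists and does
  not depend on the approximating sequence.
\<close>

definition fun_op ::
  "complex set \<Rightarrow> (complex \<Rightarrow> complex) \<Rightarrow> (complex^'n \<Rightarrow> complex^'n) \<Rightarrow> complex^'n \<Rightarrow> complex^'n" where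
  "fun_op K f T x =
     (THE y. \<exists>p :: nat \<Rightarrow> complex poly.
        uniform_limit K (\<lambda>k. poly (p k)) f sequentially \<and>
        (\<lambda>k. poly_op (p k) T x) \<longlonglongrightarrow> y)"

definition crouzeix_ratio :: "complex^'n^'n \<Rightarrow> (complex \<Rightarrow> complex) \<Rightarrow> real" where
  "crouzeix_ratio A f =
     onorm (fun_op (numerical_range A) f ((*v) A)) / (SUP z\<in>numerical_range A. cmod (f z))"

text \<open>
  Elements of the algebra are functions on \<open>W(A)\<close>: being identically zero refers to \<open>W(A)\<close>, and
  values elsewhere are irrelevant throughout.
\<close>

definition extremal_function :: "complex^'n^'n \<Rightarrow> (complex \<Rightarrow> complex) \<Rightarrow> bool" where
  "extremal_function A f \<longleftrightarrow>
     is_arg_max (crouzeix_ratio A)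
       (\<lambda>g. g \<in> analytic_algebra (numerical_range A) \<and> (\<exists>z\<in>numerical_range A. g z \<noteq> 0)) f"

definition extremal_vector :: "complex^'n^'n \<Rightarrow> complex^'n \<Rightarrow> bool" where
  "extremal_vector A x \<longleftrightarrow>
     (\<exists>f. extremal_function A f \<and> x \<noteq> 0 \<and>
        norm (fun_op (numerical_range A) f ((*v) A) x) =
          onorm (fun_op (numerical_range A) f ((*v) A)) * norm x)"

definition orth_proj :: "(complex^'n) set \<Rightarrow> complex^'n \<Rightarrow> complex^'n" where
  "orth_proj V x = (THE y. y \<in> V \<and> (\<forall>v\<in>V. cinner (x - y) v = 0))"

definition compression :: "complex^'n^'n \<Rightarrow> (complex^'n) set \<Rightarrow> complex^'n \<Rightarrow> complex^'n" where
  "compression A V x = orth_proj V (A *v x)"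

definition cyclic_subspace :: "complex^'n^'n \<Rightarrow> complex^'n \<Rightarrow> (complex^'n) set" where
  "cyclic_subspace A y = vec.span (range (\<lambda>k. (((*v) A) ^^ k) y))"

definition cyclic_vector :: "complex^'n^'n \<Rightarrow> complex^'n \<Rightarrow> bool" where
  "cyclic_vector A y \<longleftrightarrow> cyclic_subspace A y = UNIV"

definition cyclic_matrix :: "complex^'n^'n \<Rightarrow> bool" where
  "cyclic_matrix A \<longleftrightarrow> (\<exists>y. cyclic_vector A y)"

end

theory Submission
  imports Defs "HOL-Complex_Analysis.Complex_Analysis"
    "HOL-Computational_Algebra.Fundamental_Theorem_Algebra"
begin

text \<open>
  Everything reduces to Crouzeix's theorem for operators on spaces of dimension at most two. After an
  affine normalisation such an operator is upper triangular with diagonal \<open>(1, -1)\<close> and off-diagonal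
  entry \<open>c \<ge> 0\<close>, and its numerical range is a filled ellipse with foci \<open>\<plusminus>1\<close>. The norm of \<open>p(A)\<close>
  depends only on \<open>p(1)\<close> and \<open>p(-1)\<close>; by the Schwarz--Pick lemma these are close in the
  pseudohyperbolic metric as soon as there is a holomorphic map \<open>g\<close> from the disc into the ellipse with
  \<open>g(\<plusminus>t) = \<plusminus>1\<close>. The bound 2 follows when \<open>c \<le> 2/t - t/2\<close>. Instead of the conformal map (which
  involves elliptic functions) a polynomial of degree five that approximates it is good
  enough; for \<open>c \<le> 3/2\<close> the trivial bounds on \<open>p(\<plusminus>1)\<close> suffice.

  To identify \<open>f(A)\<close>, functions in the algebra are approximated by polynomials on the convex set
  \<open>W(A)\<close> (dilation and Cauchy's formula), and polynomials that tend to zero uniformly on \<open>W(A)\<close> also tend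
  to zero at \<open>A\<close>, since the eigenvalues on the boundary of \<open>W(A)\<close> are semisimple.
\<close>

section \<open>Upper triangular two by two matrices\<close>

text \<open>The bound 2 is needed only where an extremal function attains its norm: on the
  compression, or on the cyclic subspace of an extremal vector. Hence
  \<open>crouzeix_dim_le_2\<close> speaks of an operator, an invariant subspace and any set
  \<open>W\<close> that contains the numerical range there. The threshold 3/2 is where the trivial
  bounds stop: for values of modulus 1 and opposite sign at 1 and -1 they give exactly norm 2. It is
  also the value of 2/t - t/2 at t = 1, so every larger \<open>c\<close> has its \<open>t\<close> in
  the open unit interval, and the polynomial map only has to work for \<epsilon> = t^2/4 < 1/4. The
  functional calculus is a definite description, so independence of the approximating sequence has
  to be proved before any value is known. In dimension at most two the bound itself provides it. For
  \<open>A\<close> on the whole space no norm estimate is at hand; there the argument is algebraic,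
  by induction on the degree of an annihilating polynomial of a single vector.\<close>

lemma binary_form_nonneg:
  fixes p q r x y :: real
  assumes "p > 0" "r\<^sup>2 \<le> p * q"
  shows "2 * r * x * y \<le> p * x\<^sup>2 + q * y\<^sup>2"
proof -
  have "0 \<le> (p * x - r * y)\<^sup>2 + (p * q - r\<^sup>2) * y\<^sup>2"
    using assms by (intro add_nonneg_nonneg mult_nonneg_nonneg) auto
  also have "\<dots> = p * (p * x\<^sup>2 + q * y\<^sup>2 - 2 * r * x * y)"
    by (simp add: power2_eq_square algebra_simps)
  finally show ?thesis
    using assms(1) by (simp add: zero_le_mult_iff)
qed

text \<open>For the matrix M with rows (\<alpha>, \<gamma>) and (0, \<beta>), the form 4 - M^H M is
  positive semidefinite: its determinant is four times the slack in the first hypothesis, and its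
  upper left entry 4 - |\<alpha>|^2 is positive.\<close>

lemma upper_triangular_norm_le_2:
  fixes \<alpha> \<beta> \<gamma> \<xi> \<eta> :: complex
  assumes "(cmod \<alpha>)\<^sup>2 + (cmod \<beta>)\<^sup>2 + (cmod \<gamma>)\<^sup>2 \<le> 4 + (cmod \<alpha>)\<^sup>2 * (cmod \<beta>)\<^sup>2 / 4"
    and "cmod \<alpha> \<le> 1"
  shows "(cmod (\<alpha> * \<xi> + \<gamma> * \<eta>))\<^sup>2 + (cmod (\<beta> * \<eta>))\<^sup>2 \<le> 4 * ((cmod \<xi>)\<^sup>2 + (cmod \<eta>)\<^sup>2)"
proof -
  define a b g x y where "a = cmod \<alpha>" and "b = cmod \<beta>" and "g = cmod \<gamma>"
    and "x = cmod \<xi>" and "y = cmod \<eta>"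
  have a: "0 \<le> a" "a \<le> 1" "a\<^sup>2 \<le> 1" using assms(2) by (auto simp: a_def power_le_one)
  have "2 * (a * g) * x * y \<le> (4 - a\<^sup>2) * x\<^sup>2 + (4 - b\<^sup>2 - g\<^sup>2) * y\<^sup>2"
  proof (rule binary_form_nonneg)
    show "(a * g)\<^sup>2 \<le> (4 - a\<^sup>2) * (4 - b\<^sup>2 - g\<^sup>2)"
      using assms(1) unfolding a_def[symmetric] b_def[symmetric] g_def[symmetric]
      by (simp add: power2_eq_square algebra_simps)
  qed (use a in auto)
  moreover have "(cmod (\<alpha> * \<xi> + \<gamma> * \<eta>))\<^sup>2 \<le> (a * x + g * y)\<^sup>2"
    by (rule power_mono) (auto simp: a_def g_def x_def y_def norm_mult intro: norm_triangle_le)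
  ultimately show ?thesis
    by (simp add: a_def[symmetric] b_def[symmetric] g_def[symmetric] x_def[symmetric] y_def[symmetric]
        norm_mult power2_eq_square algebra_simps)
qed

text \<open>Written in s = a + b and g = a b, the claim reduces to 5s/4 \<le> 2 + g/2, which follows
  from s \<le> 1 + g. Equality at a = b = 1, D = 2, c = 3/2 shows where the constant 3/2 comes
  from.\<close>

lemma triangular_entries_bound_small:
  fixes a b D c :: real
  assumes "0 \<le> a" "a \<le> 1" "0 \<le> b" "b \<le> 1" "0 \<le> D" "D \<le> a + b" "0 \<le> c" "c \<le> 3/2"
  shows "a\<^sup>2 + b\<^sup>2 + (c * D / 2)\<^sup>2 \<le> 4 + a\<^sup>2 * b\<^sup>2 / 4"
proof -
  define s g where "s = a + b" and "g = a * b"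
  have "c * D \<le> 3/2 * s" unfolding s_def by (intro mult_mono) (use assms in auto)
  hence "(c * D / 2)\<^sup>2 \<le> (3/4 * s)\<^sup>2"
    by (intro power_mono) (use assms in \<open>auto simp: s_def mult.commute\<close>)
  moreover have "0 \<le> (1 - a) * (1 - b)" using assms by simp
  hence sg: "s \<le> 1 + g" by (simp add: s_def g_def algebra_simps)
  have g: "0 \<le> g" "g \<le> 1" using assms by (auto simp: g_def mult_le_one)
  have "5/4 * s \<le> 2 + g/2" using sg g by simp
  hence "(5/4 * s)\<^sup>2 \<le> (2 + g/2)\<^sup>2" by (rule power_mono) (use assms in \<open>auto simp: s_def\<close>)
  moreover have "a\<^sup>2 + b\<^sup>2 = s\<^sup>2 - 2 * g" "a\<^sup>2 * b\<^sup>2 = g\<^sup>2"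
    by (auto simp: s_def g_def power2_eq_square algebra_simps)
  ultimately show ?thesis by (simp add: power2_eq_square algebra_simps)
qed

text \<open>The claim is s^2 + c^2 D^2 / 4 \<le> (2 + g/2)^2. Of the two bounds on \<open>D\<close>,
  the triangle inequality grows with s and the Schwarz-Pick bound \<open>SP\<close> decreases with
  s; for small g both are needed, for large g the second suffices.\<close>

lemma triangular_entries_bound_large:
  fixes a b D t c :: real
  assumes "0 \<le> a" "a \<le> 1" "0 \<le> b" "b \<le> 1" "0 \<le> D" "D \<le> a + b" "0 < t" "t < 1"
    and c: "c = 2 / t - t / 2"
    and SP: "D\<^sup>2 * (1 - t\<^sup>2)\<^sup>2 \<le> 4 * t\<^sup>2 * ((1 - a\<^sup>2) * (1 - b\<^sup>2))"
  shows "a\<^sup>2 + b\<^sup>2 + (c * D / 2)\<^sup>2 \<le> 4 + a\<^sup>2 * b\<^sup>2 / 4"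
proof -
  define s g where "s = a + b" and "g = a * b"
  define T where "T = t\<^sup>2"
  have T: "0 < T" "T < 1" using assms by (auto simp: T_def power_less_one_iff)
  have g: "0 \<le> g" "g \<le> 1" using assms by (auto simp: g_def mult_le_one)
  have sg: "4 * g \<le> s\<^sup>2"
    using zero_le_power2[of "a - b"] by (simp add: s_def g_def power2_eq_square algebra_simps)
  have ab: "a\<^sup>2 + b\<^sup>2 = s\<^sup>2 - 2 * g" "a\<^sup>2 * b\<^sup>2 = g\<^sup>2" "(1 - a\<^sup>2) * (1 - b\<^sup>2) = (1 + g)\<^sup>2 - s\<^sup>2"
    by (auto simp: s_def g_def power2_eq_square algebra_simps)
  have c2: "c\<^sup>2 * T = (2 - T / 2)\<^sup>2"
  proof -
    have "c * t = 2 - T / 2" using assms(7) by (simp add: c T_def power2_eq_square field_simps)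
    thus ?thesis by (metis T_def power_mult_distrib)
  qed
  have D1: "D\<^sup>2 \<le> s\<^sup>2" using assms by (auto simp: s_def intro: power_mono)
  have D2: "D\<^sup>2 * (1 - T)\<^sup>2 \<le> 4 * T * ((1 + g)\<^sup>2 - s\<^sup>2)" using SP by (simp add: ab T_def)
  define E where "E = c\<^sup>2 * D\<^sup>2"
  have E1: "E * T \<le> (2 - T / 2)\<^sup>2 * s\<^sup>2"
    using mult_left_mono[OF D1, of "c\<^sup>2 * T"] T unfolding E_def c2[symmetric] by (simp add: algebra_simps)
  have E2: "E * (1 - T)\<^sup>2 \<le> 4 * (2 - T / 2)\<^sup>2 * ((1 + g)\<^sup>2 - s\<^sup>2)"
    using mult_left_mono[OF D2, of "c\<^sup>2"] unfolding E_def c2[symmetric] by (simp add: algebra_simps)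
  have goal: "s\<^sup>2 - 2 * g + E / 4 \<le> 4 + g\<^sup>2 / 4"
  proof (cases "g \<le> T")
    case True
    define S where "S = s\<^sup>2"
    \<comment> \<open>The right side exceeds the left by 3(T - g)/2. The squared inequality is the
      claim at the value of s where the two bounds on \<open>D\<close> coincide.\<close>
    have "2 * (1 + g) * (1 + T / 4) \<le> (1 + T) * (2 + g / 2)"
      using True by (simp add: field_simps)
    hence "(2 * (1 + g) * (1 + T / 4))\<^sup>2 \<le> ((1 + T) * (2 + g / 2))\<^sup>2"
      by (rule power_mono) (use T g in auto)
    hence key: "4 * (1 + g)\<^sup>2 * (1 + T / 4)\<^sup>2 \<le> (1 + T)\<^sup>2 * (2 + g / 2)\<^sup>2"
      by (simp only: power_mult_distrib) simp
    \<comment> \<open>The two bounds on \<open>D\<close> agree exactly when S (1 + T)^2 = 4 T (1 +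
      g)^2; below this value \<open>E1\<close> is used, above it \<open>E2\<close>.\<close>
    show ?thesis
    proof (cases "S * (1 + T)\<^sup>2 \<le> 4 * T * (1 + g)\<^sup>2")
      case True
      have "S * (1 + T / 4)\<^sup>2 * (1 + T)\<^sup>2 \<le> 4 * T * (1 + g)\<^sup>2 * (1 + T / 4)\<^sup>2"
        using mult_right_mono[OF True, of "(1 + T / 4)\<^sup>2"] by (simp add: algebra_simps)
      also have "\<dots> \<le> T * (2 + g / 2)\<^sup>2 * (1 + T)\<^sup>2"
        using mult_left_mono[OF key, of T] T by (simp add: algebra_simps)
      finally have "S * (1 + T / 4)\<^sup>2 \<le> T * (2 + g / 2)\<^sup>2"
        using T by simp
      moreover have "S * T + (2 - T / 2)\<^sup>2 * S / 4 = S * (1 + T / 4)\<^sup>2"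
        by (simp add: power2_eq_square field_simps)
      ultimately have "T * (S + E / 4) \<le> T * (2 + g / 2)\<^sup>2"
        using E1 by (simp add: S_def algebra_simps)
      hence "S + E / 4 \<le> (2 + g / 2)\<^sup>2" using T by simp
      thus ?thesis by (simp add: S_def power2_eq_square algebra_simps)
    next
      case False
      \<comment> \<open>As a function of \<open>S\<close>, the bound obtained from \<open>E2\<close>
        has slope -L \<le> 0, so it may be evaluated at the crossing point.\<close>
      define L where "L = (2 - T / 2)\<^sup>2 - (1 - T)\<^sup>2"
      have "(1 - T)\<^sup>2 \<le> (2 - T / 2)\<^sup>2" by (rule power_mono) (use T in auto)
      hence L: "0 \<le> L" by (simp add: L_def)
      have "(1 + T)\<^sup>2 * ((1 - T)\<^sup>2 * S + (2 - T / 2)\<^sup>2 * ((1 + g)\<^sup>2 - S))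
          = (1 + T)\<^sup>2 * (2 - T / 2)\<^sup>2 * (1 + g)\<^sup>2 - L * (S * (1 + T)\<^sup>2)"
        by (simp add: L_def algebra_simps)
      also have "\<dots> \<le> (1 + T)\<^sup>2 * (2 - T / 2)\<^sup>2 * (1 + g)\<^sup>2 - L * (4 * T * (1 + g)\<^sup>2)"
        using mult_left_mono[of "4 * T * (1 + g)\<^sup>2" "S * (1 + T)\<^sup>2" L] L False by simp
      also have "\<dots> = (1 - T)\<^sup>2 * (4 * (1 + g)\<^sup>2 * (1 + T / 4)\<^sup>2)"
        by (simp add: L_def power2_eq_square field_simps)
      also have "\<dots> \<le> (1 - T)\<^sup>2 * ((1 + T)\<^sup>2 * (2 + g / 2)\<^sup>2)"
        using key by (rule mult_left_mono) auto
      finally have "(1 + T)\<^sup>2 * ((1 - T)\<^sup>2 * S + (2 - T / 2)\<^sup>2 * ((1 + g)\<^sup>2 - S))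
          \<le> (1 + T)\<^sup>2 * ((1 - T)\<^sup>2 * (2 + g / 2)\<^sup>2)" by (simp add: algebra_simps)
      hence "(1 - T)\<^sup>2 * S + (2 - T / 2)\<^sup>2 * ((1 + g)\<^sup>2 - S) \<le> (1 - T)\<^sup>2 * (2 + g / 2)\<^sup>2"
        using T by simp
      hence "(1 - T)\<^sup>2 * (S + E / 4) \<le> (1 - T)\<^sup>2 * (2 + g / 2)\<^sup>2"
        using E2 by (simp add: S_def algebra_simps)
      hence "S + E / 4 \<le> (2 + g / 2)\<^sup>2" using T by simp
      thus ?thesis by (simp add: S_def power2_eq_square algebra_simps)
    qed
  next
    case False
    define L where "L = (2 - T / 2)\<^sup>2 - (1 - T)\<^sup>2"
    have "(1 - T)\<^sup>2 \<le> (2 - T / 2)\<^sup>2" by (rule power_mono) (use T in auto)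
    hence L: "0 \<le> L" by (simp add: L_def)
    \<comment> \<open>The bound from \<open>E2\<close> decreases in s^2, whose least value is 4g
      (when a = b). What remains there is this inequality, with slack 3(g - T)/2.\<close>
    have "(2 - T / 2) * (1 - g) \<le> (2 - g / 2) * (1 - T)"
      using False by (simp add: field_simps)
    hence "((2 - T / 2) * (1 - g))\<^sup>2 \<le> ((2 - g / 2) * (1 - T))\<^sup>2"
      by (rule power_mono) (use T g in auto)
    hence key: "(2 - T / 2)\<^sup>2 * (1 - g)\<^sup>2 \<le> (2 - g / 2)\<^sup>2 * (1 - T)\<^sup>2"
      by (simp add: power_mult_distrib)
    have "(1 - T)\<^sup>2 * (s\<^sup>2 - 4 * g) + (2 - T / 2)\<^sup>2 * ((1 + g)\<^sup>2 - s\<^sup>2)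
        = (2 - T / 2)\<^sup>2 * (1 - g)\<^sup>2 - L * (s\<^sup>2 - 4 * g)"
      unfolding L_def by algebra
    also have "\<dots> \<le> (1 - T)\<^sup>2 * (2 - g / 2)\<^sup>2"
      using key mult_nonneg_nonneg[OF L, of "s\<^sup>2 - 4 * g"] sg by (simp add: algebra_simps)
    finally have "(1 - T)\<^sup>2 * (s\<^sup>2 - 4 * g + E / 4) \<le> (1 - T)\<^sup>2 * (2 - g / 2)\<^sup>2"
      using E2 by (simp add: algebra_simps)
    hence "s\<^sup>2 - 4 * g + E / 4 \<le> (2 - g / 2)\<^sup>2" using T by simp
    thus ?thesis by (simp add: power2_eq_square algebra_simps)
  qed
  thus ?thesis by (simp add: ab E_def power_mult_distrib power_divide algebra_simps)
qed

section \<open>The Schwarz--Pick lemma on the ellipse\<close>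

text \<open>
  To first order the conformal map onto the ellipse with semi-axes \<open>1 \<plusminus> \<epsilon>\<close> is \<open>z + \<epsilon> z\<^sup>3\<close>. The
  coefficient of \<open>z\<^sup>5\<close> cancels the second harmonic of the error on the boundary, and the denominator
  makes the foci \<open>\<plusminus>2 sqrt \<epsilon>\<close> fixed points.
\<close>

lemma circle_into_ellipse:
  fixes z :: complex and \<epsilon> :: real
  assumes "cmod z = 1" "0 < \<epsilon>" "\<epsilon> < 1/4"
  defines "w \<equiv> z * (1 + \<epsilon> * z^2 + 2 * \<epsilon>^2 * z^4) / (1 + 4 * \<epsilon>^2 + 32 * \<epsilon>^4)"
  shows "(Re w)\<^sup>2 * (1 - \<epsilon>)\<^sup>2 + (Im w)\<^sup>2 * (1 + \<epsilon>)\<^sup>2 \<le> (1 - \<epsilon>\<^sup>2)\<^sup>2"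
proof -
  define Z where "Z = z\<^sup>2"
  have nZ: "cmod Z = 1" using assms(1) by (simp add: Z_def norm_power)
  define u where "u = 1 + \<epsilon> * Z + 2 * \<epsilon>^2 * Z^2"
  define x y where "x = Re Z" and "y = Im Z"
  have xy: "x\<^sup>2 + y\<^sup>2 = 1" using nZ cmod_power2[of Z] by (simp add: x_def y_def)
  have x: "\<bar>x\<bar> \<le> 1" using abs_Re_le_cmod[of Z] nZ by (simp add: x_def)
  define A where "A = 1 + 4 * \<epsilon>^2 + 32 * \<epsilon>^4"
  define v where "v = z * u"
  have A: "A > 0" by (auto simp: A_def intro!: add_pos_nonneg)
  have w: "w = v / of_real A"
    by (simp add: w_def v_def u_def Z_def A_def power_mult[symmetric])
  \<comment> \<open>The form equals (1 + \<epsilon>^2) |v|^2 - 2 \<epsilon> Re (v^2); since |z| = 1,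
    everything becomes a function of Z = z^2.\<close>
  have quad: "(Re v)\<^sup>2 * (1 - \<epsilon>)\<^sup>2 + (Im v)\<^sup>2 * (1 + \<epsilon>)\<^sup>2 = (1 + \<epsilon>\<^sup>2) * (cmod u)\<^sup>2 - 2 * \<epsilon> * Re (Z * u\<^sup>2)"
  proof -
    have vu: "v\<^sup>2 = Z * u\<^sup>2" "cmod v = cmod u"
      using assms(1) by (simp_all add: v_def Z_def power_mult_distrib norm_mult)
    have "Re (Z * u\<^sup>2) = (Re v)\<^sup>2 - (Im v)\<^sup>2"
      unfolding vu(1)[symmetric] by (simp add: power2_eq_square)
    moreover have "(cmod u)\<^sup>2 = (Re v)\<^sup>2 + (Im v)\<^sup>2"
      unfolding vu(2)[symmetric] by (simp add: cmod_power2)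
    ultimately show ?thesis by (simp only:) (simp add: power2_eq_square algebra_simps)
  qed
  have ReZ2: "Re (Z^2) = 2 * x\<^sup>2 - 1" using xy by (simp add: x_def y_def power2_eq_square)
  have modu: "(cmod u)\<^sup>2 = 1 + \<epsilon>\<^sup>2 + 4 * \<epsilon>^4 + 2 * (\<epsilon> + 2 * \<epsilon>^3) * x + 4 * \<epsilon>\<^sup>2 * (2 * x\<^sup>2 - 1)"
  proof -
    have y2: "y\<^sup>2 = 1 - x\<^sup>2" using xy by simp
    have "Re u = 1 + \<epsilon> * x + 2 * \<epsilon>^2 * (x\<^sup>2 - y\<^sup>2)"
      by (simp add: u_def x_def y_def power2_eq_square algebra_simps)
    also have "x\<^sup>2 - y\<^sup>2 = 2 * x\<^sup>2 - 1" using y2 by simp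
    finally have Reu: "Re u = 1 + \<epsilon> * x + 2 * \<epsilon>^2 * (2 * x\<^sup>2 - 1)" .
    have Imu: "Im u = y * (\<epsilon> + 4 * \<epsilon>^2 * x)"
      by (simp add: u_def x_def y_def power2_eq_square algebra_simps)
    have "(cmod u)\<^sup>2 = (1 + \<epsilon> * x + 2 * \<epsilon>^2 * (2 * x\<^sup>2 - 1))\<^sup>2 + y\<^sup>2 * (\<epsilon> + 4 * \<epsilon>^2 * x)\<^sup>2"
      by (simp only: cmod_power2 Reu Imu power_mult_distrib)
    also have "\<dots> = 1 + \<epsilon>\<^sup>2 + 4 * \<epsilon>^4 + 2 * (\<epsilon> + 2 * \<epsilon>^3) * x + 4 * \<epsilon>\<^sup>2 * (2 * x\<^sup>2 - 1)"
      unfolding y2 by algebra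
    finally show ?thesis .
  qed
  define R where "R = 5 * \<epsilon>^2 * Z^3 + 4 * \<epsilon>^3 * Z^4 + 4 * \<epsilon>^4 * Z^5"
  have "Z * u\<^sup>2 = Z + 2 * \<epsilon> * Z^2 + R"
    unfolding u_def R_def by (simp add: eval_nat_numeral algebra_simps)
  hence ReZu: "Re (Z * u\<^sup>2) = x + 2 * \<epsilon> * (2 * x\<^sup>2 - 1) + Re R"
    using ReZ2 by (simp add: x_def)
  have "cmod R \<le> 5 * \<epsilon>^2 + 4 * \<epsilon>^3 + 4 * \<epsilon>^4"
    unfolding R_def by (intro norm_triangle_le add_mono) (use nZ assms in \<open>auto simp: norm_mult norm_power\<close>)
  hence R: "- Re R \<le> 5 * \<epsilon>^2 + 4 * \<epsilon>^3 + 4 * \<epsilon>^4" using abs_Re_le_cmod[of R] by simp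
  \<comment> \<open>The leading terms 2 \<epsilon> x and 4 \<epsilon>^2 (2 x^2 - 1) occur with both
    signs and cancel, which leaves harmonics of order \<epsilon>^3 and higher.\<close>
  have "(Re v)\<^sup>2 * (1 - \<epsilon>)\<^sup>2 + (Im v)\<^sup>2 * (1 + \<epsilon>)\<^sup>2
      = (1 + \<epsilon>\<^sup>2) * (1 + \<epsilon>\<^sup>2 + 4 * \<epsilon>^4) + (6 * \<epsilon>^3 + 4 * \<epsilon>^5) * x + 4 * \<epsilon>^4 * (2 * x\<^sup>2 - 1) + 2 * \<epsilon> * (- Re R)"
    unfolding quad modu ReZu by (simp add: eval_nat_numeral algebra_simps)
  also have "\<dots> \<le> (1 + \<epsilon>\<^sup>2) * (1 + \<epsilon>\<^sup>2 + 4 * \<epsilon>^4) + (6 * \<epsilon>^3 + 4 * \<epsilon>^5) * 1 + 4 * \<epsilon>^4 * 1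
      + 2 * \<epsilon> * (5 * \<epsilon>^2 + 4 * \<epsilon>^3 + 4 * \<epsilon>^4)"
  proof (intro add_mono mult_left_mono order_refl)
    show "x \<le> 1" using x by simp
    show "2 * x\<^sup>2 - 1 \<le> 1" using xy by (smt (verit) zero_le_power2)
  qed (use R assms in auto)
  also have "\<dots> = 1 + 2 * \<epsilon>^2 + 16 * \<epsilon>^3 + 17 * \<epsilon>^4 + 12 * \<epsilon>^5 + 4 * \<epsilon>^6"
    by (simp add: eval_nat_numeral algebra_simps)
  also have "\<dots> \<le> ((1 - \<epsilon>\<^sup>2) * A)\<^sup>2"
  proof -
    define e2 where "e2 = \<epsilon>^2"
    have e: "\<epsilon> * e2 \<le> e2 / 4" "\<epsilon> * e2^2 \<le> e2^2 / 4" "0 \<le> e2"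
      using assms mult_right_mono[of \<epsilon> "1/4" e2] mult_right_mono[of \<epsilon> "1/4" "e2^2"] by (auto simp: e2_def)
    have e2: "e2 \<le> 1/16" using assms power_mono[of \<epsilon> "1/4" 2] by (simp add: e2_def power2_eq_square)
    have e3: "e2 * e2^2 \<le> e2^2 / 16" using mult_right_mono[OF e2, of "e2^2"] by simp
    have e4: "e2^2 * e2^2 \<le> e2^2 / 256" 
      using mult_right_mono[OF power_mono[OF e2 e(3), of 2], of "e2^2"] by (simp add: power2_eq_square)
    have "1 + 2 * \<epsilon>^2 + 16 * \<epsilon>^3 + 17 * \<epsilon>^4 + 12 * \<epsilon>^5 + 4 * \<epsilon>^6
      = 1 + 2 * e2 + 16 * (\<epsilon> * e2) + 17 * e2^2 + 12 * (\<epsilon> * e2^2) + 4 * (e2 * e2^2)"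
      by (simp add: e2_def eval_nat_numeral)
    \<comment> \<open>Since \<epsilon> < 1/4, the cubic term 16 \<epsilon>^3 is at most 4
      \<epsilon>^2, and the coefficient 2 + 4 = 6 is just what the square of 1 + 3 e2 offers. The 11
      below is chosen so that 9 + 2 * 11 \<ge> 30.\<close>
    also have "\<dots> \<le> 1 + 6 * e2 + 30 * e2^2" using e e3 zero_le_power2[of e2] by linarith
    also have "\<dots> \<le> (1 + 3 * e2 + 11 * e2\<^sup>2)\<^sup>2"
    proof -
      have "0 \<le> e2 * e2^2" "0 \<le> e2^2 * e2^2" using e by simp_all
      thus ?thesis by (simp add: power2_eq_square algebra_simps)
    qed
    also have "\<dots> \<le> ((1 - \<epsilon>\<^sup>2) * A)\<^sup>2"
    proof (rule power_mono)
      have "(1 - \<epsilon>\<^sup>2) * A = 1 + 3 * e2 + 28 * e2^2 - 32 * (e2 * e2^2)"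
        by (simp add: A_def e2_def eval_nat_numeral algebra_simps)
      thus "1 + 3 * e2 + 11 * e2\<^sup>2 \<le> (1 - \<epsilon>\<^sup>2) * A"
        using e3 zero_le_power2[of e2] by linarith
    qed (use e in auto)
    finally show ?thesis .
  qed
  finally have "(Re v)\<^sup>2 * (1 - \<epsilon>)\<^sup>2 + (Im v)\<^sup>2 * (1 + \<epsilon>)\<^sup>2 \<le> ((1 - \<epsilon>\<^sup>2))\<^sup>2 * A\<^sup>2"
    by (simp add: power_mult_distrib)
  thus ?thesis using A by (simp add: w power_divide field_simps)
qed

text \<open>The filled ellipse with foci -1, 1 and minor semi-axis \<open>C\<close> is a linear
  image of the unit sphere in real dimension three, with coordinates (u, Re \<zeta>, Im
  \<zeta>).\<close>

lemma ellipse_point: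
  fixes C X Y :: real
  assumes "C > 0" "X\<^sup>2 / (1 + C\<^sup>2) + Y\<^sup>2 / C\<^sup>2 \<le> 1"
  shows "\<exists>u \<zeta>. u\<^sup>2 + (cmod \<zeta>)\<^sup>2 = 1 \<and> Complex X Y = of_real u + of_real C * \<zeta>"
proof -
  define Q where "Q = 1 + C\<^sup>2"
  have Q: "Q > 0" by (auto simp: Q_def intro: add_pos_nonneg)
  define s where "s = sqrt ((1 - X\<^sup>2 / Q - Y\<^sup>2 / C\<^sup>2) / Q)"
  have s: "s\<^sup>2 = (1 - X\<^sup>2 / Q - Y\<^sup>2 / C\<^sup>2) / Q"
    unfolding s_def using assms Q by (intro real_sqrt_pow2 divide_nonneg_pos) (auto simp: Q_def)
  \<comment> \<open>(X/Q, C X/Q) is the shortest preimage of \<open>X\<close> under u + C Re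
    \<zeta>; the multiple \<open>s\<close> of the kernel vector (C, -1) supplies the missing
    length.\<close>
  define u \<zeta> where "u = X / Q + C * s" and "\<zeta> = Complex (C * X / Q - s) (Y / C)"
  have "u\<^sup>2 + (C * X / Q - s)\<^sup>2 = X\<^sup>2 * (1 + C\<^sup>2) / Q\<^sup>2 + s\<^sup>2 * (1 + C\<^sup>2)"
    using Q by (simp add: u_def power2_eq_square divide_simps) (simp add: algebra_simps)
  also have "\<dots> = X\<^sup>2 / Q + s\<^sup>2 * Q" unfolding Q_def[symmetric] using Q by (simp add: power2_eq_square)
  also have "\<dots> = 1 - (Y / C)\<^sup>2" using Q by (simp add: s power_divide)
  finally have "u\<^sup>2 + (cmod \<zeta>)\<^sup>2 = 1" by (simp add: cmod_power2 \<zeta>_def)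
  moreover have "u + C * (C * X / Q - s) = X * (1 + C\<^sup>2) / Q"
    by (simp add: u_def power2_eq_square add_divide_distrib algebra_simps)
  hence "u + C * (C * X / Q - s) = X" using Q by (simp add: Q_def)
  hence "Complex X Y = of_real u + of_real C * \<zeta>"
    using assms(1) by (simp add: complex_eq_iff \<zeta>_def)
  ultimately show ?thesis by blast
qed


text \<open>Moebius maps on both sides move -t and its image to 0, where the Schwarz lemma applies.
  The result is freed of denominators to match
  \<open>triangular_entries_bound_large\<close>.\<close>

lemma Schwarz_Pick_symmetric:
  assumes holf: "f holomorphic_on ball 0 1" and lt1: "\<And>z. cmod z < 1 \<Longrightarrow> cmod (f z) < 1"
    and t: "0 < t" "t < 1"
  shows "(cmod (f (of_real t) - f (- of_real t)))\<^sup>2 * (1 - t\<^sup>2)\<^sup>2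
    \<le> 4 * t\<^sup>2 * ((1 - (cmod (f (of_real t)))\<^sup>2) * (1 - (cmod (f (- of_real t)))\<^sup>2))"
proof -
  define \<alpha> \<beta> where "\<alpha> = f (of_real t)" and "\<beta> = f (- of_real t)"
  have b: "cmod \<beta> < 1" "cmod (of_real t) < 1" using t by (auto simp: \<beta>_def intro: lt1)
  define g where "g = Moebius_function 0 \<beta> \<circ> (f \<circ> Moebius_function 0 (of_real t))"
  have "f \<circ> Moebius_function 0 (of_real t) holomorphic_on ball 0 1"
    by (intro holomorphic_on_compose_gen[OF Moebius_function_holomorphic holf])
      (use b in \<open>auto simp: Moebius_function_norm_lt_1\<close>)
  hence "g holomorphic_on ball 0 1" unfolding g_def
    by (intro holomorphic_on_compose_gen[OF _ Moebius_function_holomorphic[OF b(1)]])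
      (use b in \<open>auto simp: Moebius_function_norm_lt_1 lt1\<close>)
  moreover have "g 0 = 0" by (simp add: g_def Moebius_function_def \<beta>_def)
  moreover have "cmod (g z) < 1" if "cmod z < 1" for z
    using that b by (simp add: g_def Moebius_function_norm_lt_1 lt1)
  \<comment> \<open>This is the pseudohyperbolic distance of t and -t:
    \<open>Moebius_function 0 t\<close> sends 0 to -t and \<xi> to t.\<close>
  moreover define \<xi> :: real where "\<xi> = 2 * t / (1 + t\<^sup>2)"
  have t2: "1 + t\<^sup>2 > 0" "t\<^sup>2 < 1" using t by (auto simp: add_pos_nonneg power_less_one_iff)
  have "0 < (1 - t)\<^sup>2" using t by simp
  hence xi: "0 < \<xi>" "\<xi> < 1" using t t2 by (auto simp: \<xi>_def power2_eq_square divide_simps algebra_simps)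
  ultimately have "cmod (g (of_real \<xi>)) \<le> cmod (of_real \<xi>)"
    by (intro Schwarz_Lemma(1)) auto
  moreover have "Moebius_function 0 (of_real t) (of_real \<xi>) = of_real t"
  proof -
    have "(\<xi> - t) / (1 - t * \<xi>) = t"
    proof -
      have "1 - t * \<xi> = (1 - t\<^sup>2) / (1 + t\<^sup>2)" "\<xi> - t = t * (1 - t\<^sup>2) / (1 + t\<^sup>2)"
        using t2(1) by (simp_all add: \<xi>_def power2_eq_square field_simps)
      thus ?thesis using t2 by simp
    qed
    hence "complex_of_real ((\<xi> - t) / (1 - t * \<xi>)) = of_real t" by simp
    thus ?thesis by (simp add: Moebius_function_def)
  qed
  hence "g (of_real \<xi>) = (\<alpha> - \<beta>) / (1 - cnj \<beta> * \<alpha>)"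
    by (simp add: g_def Moebius_function_def \<alpha>_def)
  moreover have a: "cmod \<alpha> < 1" using t by (auto simp: \<alpha>_def intro: lt1)
  have "cmod (cnj \<beta> * \<alpha>) < 1" using a b using norm_mult_less[of "cnj \<beta>" 1 \<alpha> 1] by simp
  hence nz: "1 - cnj \<beta> * \<alpha> \<noteq> 0" by auto
  ultimately have "cmod (\<alpha> - \<beta>) \<le> \<xi> * cmod (1 - cnj \<beta> * \<alpha>)"
    using xi by (simp add: norm_divide pos_divide_le_eq)
  hence "cmod (\<alpha> - \<beta>) * (1 + t\<^sup>2) \<le> 2 * t * cmod (1 - cnj \<beta> * \<alpha>)"
    using t2 by (simp add: \<xi>_def field_simps)
  hence "(cmod (\<alpha> - \<beta>) * (1 + t\<^sup>2))\<^sup>2 \<le> (2 * t * cmod (1 - cnj \<beta> * \<alpha>))\<^sup>2"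
    by (rule power_mono) (use t2 in auto)
  hence "(cmod (\<alpha> - \<beta>))\<^sup>2 * (1 + t\<^sup>2)\<^sup>2 \<le> 4 * t\<^sup>2 * (cmod (1 - cnj \<beta> * \<alpha>))\<^sup>2"
    by (simp add: power_mult_distrib)
  \<comment> \<open>After this identity and the next, both sides contain 4 t^2 |\<alpha> -
    \<beta>|^2, which cancels.\<close>
  also have "(cmod (1 - cnj \<beta> * \<alpha>))\<^sup>2 = (cmod (\<alpha> - \<beta>))\<^sup>2 + (1 - (cmod \<alpha>)\<^sup>2) * (1 - (cmod \<beta>)\<^sup>2)"
    unfolding cmod_power2 by (simp add: power2_eq_square algebra_simps)
  also have "(1 + t\<^sup>2)\<^sup>2 = (1 - t\<^sup>2)\<^sup>2 + 4 * t\<^sup>2"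
    by (simp add: power2_eq_square algebra_simps)
  finally show ?thesis
    unfolding \<alpha>_def[symmetric] \<beta>_def[symmetric] by (simp add: distrib_left)
qed

text \<open>This is the infinitesimal version, for a double eigenvalue, where the ellipse is a disc
  and the divided difference a derivative.\<close>

lemma Schwarz_Pick_deriv:
  assumes holf: "f holomorphic_on ball 0 1" and lt1: "\<And>z. cmod z < 1 \<Longrightarrow> cmod (f z) < 1"
    and der: "(f has_field_derivative f') (at 0)"
  shows "cmod f' \<le> 1 - (cmod (f 0))\<^sup>2"
proof -
  define \<alpha> where "\<alpha> = f 0"
  have a: "cmod \<alpha> < 1" by (simp add: \<alpha>_def lt1)
  hence a2: "(cmod \<alpha>)\<^sup>2 < 1" by (simp add: power_less_one_iff)
  define g where "g = Moebius_function 0 \<alpha> \<circ> f"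
  have "g holomorphic_on ball 0 1" unfolding g_def
    by (intro holomorphic_on_compose_gen[OF holf Moebius_function_holomorphic[OF a]]) (auto intro: lt1)
  moreover have "g 0 = 0" by (simp add: g_def Moebius_function_def \<alpha>_def)
  moreover have "cmod (g z) < 1" if "cmod z < 1" for z
    using that a by (simp add: g_def Moebius_function_norm_lt_1 lt1)
  ultimately have "cmod (deriv g 0) \<le> 1" by (intro Schwarz_Lemma(2)[of g 0]) auto
  moreover have nz: "1 - cnj \<alpha> * \<alpha> = of_real (1 - (cmod \<alpha>)\<^sup>2)"
    by (simp add: complex_norm_square mult.commute del: of_real_power)
  have nz': "1 - cnj \<alpha> * \<alpha> \<noteq> 0" unfolding nz of_real_eq_0_iff using a2 by simp
  have "(g has_field_derivative f' / (1 - cnj \<alpha> * \<alpha>)) (at 0)"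
    unfolding g_def o_def Moebius_function_def
    by (rule derivative_eq_intros der refl | use nz' in \<open>simp add: \<alpha>_def[symmetric]\<close>)+
  hence "deriv g 0 = f' / (1 - cnj \<alpha> * \<alpha>)" by (rule DERIV_imp_deriv)
  ultimately have "cmod f' / (1 - (cmod \<alpha>)\<^sup>2) \<le> 1"
    unfolding nz using a2 by (simp add: norm_divide del: of_real_diff)
  thus ?thesis using a2 by (simp add: \<alpha>_def)
qed


text \<open>The numbers \<open>a (1 + u) / 2 + b (1 - u) / 2 + c \<zeta> / 2\<close> are the numerical range of the upper
  triangular matrix with diagonal \<open>(a, b)\<close> and off-diagonal entry \<open>c\<close>; its image under \<open>p\<close> has
  diagonal \<open>(p a, p b)\<close> and off-diagonal entry \<open>c\<close> times the divided difference.\<close>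

lemma crouzeix_triangular_entries:
  fixes a b c :: complex and p :: "complex poly"
  assumes B: "B < 1"
    and W: "\<And>u \<zeta>. u\<^sup>2 + (cmod \<zeta>)\<^sup>2 = 1 \<Longrightarrow>
      cmod (poly p (a * of_real ((1 + u) / 2) + b * of_real ((1 - u) / 2) + c * \<zeta> / 2)) \<le> B"
  defines "\<gamma> \<equiv> c * (if a = b then poly (pderiv p) a else (poly p a - poly p b) / (a - b))"
  shows "(cmod (poly p a))\<^sup>2 + (cmod (poly p b))\<^sup>2 + (cmod \<gamma>)\<^sup>2
    \<le> 4 + (cmod (poly p a))\<^sup>2 * (cmod (poly p b))\<^sup>2 / 4"
proof -
  define \<alpha> \<beta> where "\<alpha> = poly p a" and "\<beta> = poly p b"
  have ab: "cmod \<alpha> < 1" "cmod \<beta> < 1" using W[of 1 0] W[of "-1" 0] B by (auto simp: \<alpha>_def \<beta>_def)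
  show ?thesis
  proof (cases "a = b")
    case True
    define A where "A = (cmod \<alpha>)\<^sup>2"
    have A: "0 \<le> A" "A \<le> 1" using ab by (auto simp: A_def power_le_one)
    define f where "f = (\<lambda>z. poly p (a + c / 2 * z))"
    have "cmod (c / 2 * poly (pderiv p) a) \<le> 1 - (cmod (f 0))\<^sup>2"
    proof (rule Schwarz_Pick_deriv)
      show "f holomorphic_on ball 0 1" unfolding f_def by (intro holomorphic_intros)
      have "(f has_field_derivative poly (pderiv p) (a + c / 2 * 0) * (c / 2)) (at 0)"
        unfolding f_def by (rule DERIV_chain2[OF poly_DERIV]) (auto intro!: derivative_eq_intros)
      thus "(f has_field_derivative c / 2 * poly (pderiv p) a) (at 0)" by (simp add: mult.commute)
      fix z :: complex assume z: "cmod z < 1"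
      define u where "u = sqrt (1 - (cmod z)\<^sup>2)"
      have "u\<^sup>2 + (cmod z)\<^sup>2 = 1" using z by (simp add: u_def power_le_one)
      from W[OF this] show "cmod (f z) < 1" using B True by (simp add: f_def field_simps)
    qed
    hence "cmod \<gamma> \<le> 2 * (1 - A)" using True by (simp add: \<gamma>_def f_def A_def \<alpha>_def norm_mult norm_divide)
    hence "(cmod \<gamma>)\<^sup>2 \<le> (2 * (1 - A))\<^sup>2" by (rule power_mono) simp
    moreover have "A * A \<le> A" using A by (simp add: mult_left_le)
    ultimately have "A + A + (cmod \<gamma>)\<^sup>2 \<le> 4 + A * A / 4" 
      using A by (simp add: power2_eq_square algebra_simps)
    thus ?thesis using True by (simp add: A_def \<alpha>_def)
  next
    case False
    define D where "D = cmod (\<alpha> - \<beta>)"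
    \<comment> \<open>The off-diagonal modulus after the affine map that takes a to 1 and b to
      -1.\<close>
    define c' where "c' = 2 * cmod c / cmod (a - b)"
    have c': "0 \<le> c'" by (simp add: c'_def)
    have g: "cmod \<gamma> = c' * D / 2"
      using False by (simp add: \<gamma>_def c'_def D_def \<alpha>_def \<beta>_def norm_mult norm_divide)
    have D: "0 \<le> D" "D \<le> cmod \<alpha> + cmod \<beta>" by (auto simp: D_def norm_triangle_ineq4)
    show ?thesis
    proof (cases "c' \<le> 3/2")
      case True
      show ?thesis unfolding g \<alpha>_def[symmetric] \<beta>_def[symmetric]
        by (rule triangular_entries_bound_small) (use ab D True c' in auto)
    next
      case c'_large: False
      hence "c \<noteq> 0" by (auto simp: c'_def)
      \<comment> \<open>The positive root of t^2 + 2 c' t - 4 = 0, that is, of c' = 2/t - t/2. It is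
        below 1 precisely because c' > 3/2.\<close>
      define t where "t = sqrt (c'\<^sup>2 + 4) - c'"
      have sq: "(t + c')\<^sup>2 = c'\<^sup>2 + 4" by (simp add: t_def)
      have t: "0 < t" "t < 1"
      proof -
        have "sqrt (c'\<^sup>2) < sqrt (c'\<^sup>2 + 4)" by (rule real_sqrt_less_mono) simp
        thus "0 < t" using c' by (simp add: t_def)
        have "sqrt (c'\<^sup>2 + 4) < sqrt ((1 + c')\<^sup>2)"
          using c'_large by (intro real_sqrt_less_mono) (simp add: power2_eq_square algebra_simps)
        thus "t < 1" using c' by (simp add: t_def)
      qed
      have c't: "c' = 2 / t - t / 2"
        using sq t by (simp add: power2_eq_square field_simps)
      define \<epsilon> where "\<epsilon> = t\<^sup>2 / 4"
      have eps: "0 < \<epsilon>" "\<epsilon> < 1/4" using t by (auto simp: \<epsilon>_def power_less_one_iff)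
      define g where "g = (\<lambda>z::complex. z * (1 + \<epsilon> * z^2 + 2 * \<epsilon>^2 * z^4) / complex_of_real (1 + 4 * \<epsilon>^2 + 32 * \<epsilon>^4))"
      define G where "G = (\<lambda>z. (a + b) / 2 + (a - b) / 2 * (g z / of_real t))"
      have A: "1 + 4 * \<epsilon>^2 + 32 * \<epsilon>^4 > 0" by (auto intro!: add_pos_nonneg)
      hence A': "complex_of_real (1 + 4 * \<epsilon>^2 + 32 * \<epsilon>^4) \<noteq> 0" by (simp only: of_real_eq_0_iff)
      have holg: "g holomorphic_on X" for X
        unfolding g_def using A' by (intro holomorphic_intros)
      have circ: "cmod (poly p (G z)) \<le> B" if z: "cmod z = 1" for z
      proof -
        define w where "w = g z"
        have E: "(Re w)\<^sup>2 * (1 - \<epsilon>)\<^sup>2 + (Im w)\<^sup>2 * (1 + \<epsilon>)\<^sup>2 \<le> (1 - \<epsilon>\<^sup>2)\<^sup>2"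
          using circle_into_ellipse[OF z eps] unfolding w_def g_def by simp
        \<comment> \<open>After scaling by 1/t, the ellipse with semi-axes 1 + \<epsilon> and 1 -
          \<epsilon> has foci -1, 1 and minor semi-axis c'/2: it is the normalised numerical
          range.\<close>
        define C where "C = (1 - \<epsilon>) / t"
        have C: "C > 0" "C = c' / 2" using t eps
          by (simp_all add: C_def c't) (simp add: \<epsilon>_def power2_eq_square field_simps)
        have C1: "1 + C\<^sup>2 = ((1 + \<epsilon>) / t)\<^sup>2"
          using t by (simp add: C_def power_divide divide_simps) (simp add: \<epsilon>_def power2_eq_square algebra_simps)
        have "(1 - \<epsilon>\<^sup>2)\<^sup>2 = (1 - \<epsilon>)\<^sup>2 * (1 + \<epsilon>)\<^sup>2" by algebra
        hence "(Re w)\<^sup>2 / (1 + \<epsilon>)\<^sup>2 + (Im w)\<^sup>2 / (1 - \<epsilon>)\<^sup>2 \<le> 1"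
          using E eps by (simp add: divide_simps mult.commute)
        hence "(Re w / t)\<^sup>2 / (1 + C\<^sup>2) + (Im w / t)\<^sup>2 / C\<^sup>2 \<le> 1"
          unfolding C1 using t by (simp add: C_def power_divide)
        from ellipse_point[OF C(1) this] obtain u \<zeta> where u: "u\<^sup>2 + (cmod \<zeta>)\<^sup>2 = 1"
          and "Complex (Re w / t) (Im w / t) = of_real u + of_real C * \<zeta>" by blast
        moreover have "Complex (Re w / t) (Im w / t) = g z / of_real t"
          by (simp add: w_def complex_eq_iff)
        ultimately have gz: "g z / of_real t = of_real u + of_real C * \<zeta>" by simp
        \<comment> \<open>Only a phase separates (a - b) C from c, because C = |c| / |a - b|; the
          rotation of \<zeta> absorbs it.\<close>
        define \<zeta>' where "\<zeta>' = (a - b) * of_real C / c * \<zeta>"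
        have "cmod ((a - b) * of_real C / c) = 1"
          using C(1) False \<open>c \<noteq> 0\<close> by (simp add: norm_mult norm_divide C(2) c'_def)
        hence "cmod \<zeta>' = cmod \<zeta>" unfolding \<zeta>'_def norm_mult[of _ \<zeta>] by simp
        hence "cmod (poly p (a * of_real ((1 + u) / 2) + b * of_real ((1 - u) / 2) + c * \<zeta>' / 2)) \<le> B"
          using u by (intro W) simp
        also have "a * of_real ((1 + u) / 2) + b * of_real ((1 - u) / 2) + c * \<zeta>' / 2 = G z"
          unfolding G_def gz using \<open>c \<noteq> 0\<close> by (simp add: \<zeta>'_def field_simps)
        finally show ?thesis .
      qed
      define f where "f = (\<lambda>z. poly p (G z))"
      have holf: "f holomorphic_on X" for X
        unfolding f_def G_def using holg t by (intro holomorphic_intros) auto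
      \<comment> \<open>Only the image of the circle was controlled; the maximum principle, applied
        to \<open>f\<close> itself, carries the bound into the disc.\<close>
      have "cmod (f z) \<le> B" if "cmod z < 1" for z
      proof (rule maximum_modulus_frontier[of f "cball 0 1"])
        show "continuous_on (closure (cball 0 1)) f" by (intro holomorphic_on_imp_continuous_on holf)
        show "cmod (f z) \<le> B" if "z \<in> frontier (cball 0 1)" for z
          using that circ[of z] by (simp add: f_def)
      qed (use that holf in auto)
      hence lt1: "cmod (f z) < 1" if "cmod z < 1" for z using B that by fastforce
      have gt: "g (of_real t) = of_real t" "g (- of_real t) = - of_real t"
      proof -
        have "t * (1 + \<epsilon> * t^2 + 2 * \<epsilon>^2 * t^4) = t * (1 + 4 * \<epsilon>^2 + 32 * \<epsilon>^4)"
          by (simp add: \<epsilon>_def power_divide eval_nat_numeral)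
        hence "t * (1 + \<epsilon> * t^2 + 2 * \<epsilon>^2 * t^4) / (1 + 4 * \<epsilon>^2 + 32 * \<epsilon>^4)
            = t * (1 + 4 * \<epsilon>^2 + 32 * \<epsilon>^4) / (1 + 4 * \<epsilon>^2 + 32 * \<epsilon>^4)" by (rule arg_cong)
        also have "\<dots> = t" using A by simp
        finally have "t * (1 + \<epsilon> * t^2 + 2 * \<epsilon>^2 * t^4) / (1 + 4 * \<epsilon>^2 + 32 * \<epsilon>^4) = t" .
        hence *: "complex_of_real (t * (1 + \<epsilon> * t^2 + 2 * \<epsilon>^2 * t^4) / (1 + 4 * \<epsilon>^2 + 32 * \<epsilon>^4)) = of_real t"
          by (simp only:)
        show "g (of_real t) = of_real t" using * by (simp add: g_def)
        show "g (- of_real t) = - of_real t" using * by (simp add: g_def)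
      qed
      have "f (of_real t) = \<alpha>" "f (- of_real t) = \<beta>"
        unfolding f_def G_def gt \<alpha>_def \<beta>_def using t by (simp_all add: field_simps)
      hence "D\<^sup>2 * (1 - t\<^sup>2)\<^sup>2 \<le> 4 * t\<^sup>2 * ((1 - (cmod \<alpha>)\<^sup>2) * (1 - (cmod \<beta>)\<^sup>2))"
        using Schwarz_Pick_symmetric[OF holf lt1 t] by (simp add: D_def)
      thus ?thesis unfolding \<open>cmod \<gamma> = c' * D / 2\<close> \<alpha>_def[symmetric] \<beta>_def[symmetric]
        by (intro triangular_entries_bound_large[OF _ _ _ _ _ _ t c't]) (use ab D in auto)
    qed
  qed
qed

section \<open>Polynomials of operators\<close>

lemma cinner_add_left: "cinner (x + y) z = cinner x z + cinner y z"
  by (simp add: cinner_def sum.distrib distrib_right)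

lemma cinner_add_right: "cinner x (y + z) = cinner x y + cinner x z"
  by (simp add: cinner_def sum.distrib distrib_left)

lemma cinner_diff_left: "cinner (x - y) z = cinner x z - cinner y z"
  by (simp add: cinner_def sum_subtractf left_diff_distrib)

lemma cinner_scale_left: "cinner (c *s x) z = c * cinner x z"
  by (simp add: cinner_def sum_distrib_left mult.assoc)

lemma cinner_scale_right: "cinner x (c *s z) = cnj c * cinner x z"
  by (simp add: cinner_def sum_distrib_left mult_ac)

lemma cinner_commute: "cinner y x = cnj (cinner x y)"
  by (simp add: cinner_def mult.commute)

lemma Re_cinner: "Re (cinner x y) = inner x y"
  by (simp add: cinner_def inner_vec_def inner_complex_def)

lemma cinner_self: "cinner x x = of_real ((norm x)\<^sup>2)"
proof (rule complex_eqI)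
  show "Re (cinner x x) = Re (of_real ((norm x)\<^sup>2))"
    by (simp add: Re_cinner power2_norm_eq_inner)
  show "Im (cinner x x) = Im (of_real ((norm x)\<^sup>2))"
    by (simp add: cinner_def)
qed

lemma cinner_self_eq_1: "cinner x x = 1 \<longleftrightarrow> norm x = 1"
proof -
  have "cinner x x = 1 \<longleftrightarrow> (norm x)\<^sup>2 = 1"
    unfolding cinner_self by (metis of_real_1 of_real_eq_iff)
  thus ?thesis by (simp add: power2_eq_1_iff) (smt (verit) norm_ge_zero)
qed

lemma norm_vector_scale: "norm (c *s (x :: complex^'n)) = cmod c * norm x"
proof -
  have "(norm (c *s x))\<^sup>2 = (cmod c * norm x)\<^sup>2"
  proof -
    have cc: "cnj c * c = (complex_of_real (cmod c))\<^sup>2"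
      by (metis complex_norm_square of_real_power mult.commute)
    have "complex_of_real ((norm (c *s x))\<^sup>2) = of_real ((cmod c * norm x)\<^sup>2)"
      unfolding cinner_self[symmetric] cinner_scale_left cinner_scale_right
      by (simp add: cinner_self power_mult_distrib cc mult.assoc[symmetric])
    thus ?thesis by (simp only: of_real_eq_iff)
  qed
  thus ?thesis by (simp add: power2_eq_iff_nonneg)
qed

lemma cinner_eq_0_imp_norm_add:
  assumes "cinner x y = 0"
  shows "(norm (x + y))\<^sup>2 = (norm x)\<^sup>2 + (norm y)\<^sup>2"
proof -
  have "inner x y = 0" using assms Re_cinner[of x y] by simp
  thus ?thesis by (simp add: power2_norm_eq_inner inner_add_left inner_add_right inner_commute)
qed

lemma scaleR_eq_scale: "r *\<^sub>R (x :: complex^'n) = of_real r *s x"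
  by (simp add: vec_eq_iff scaleR_conv_of_real[where 'a=complex])

section \<open>Polynomial calculus of a linear operator, annihilating polynomials and
  eigenvectors\<close>

lemma poly_op_0 [simp]: "poly_op 0 T x = 0"
  by (simp add: poly_op_def)

lemma poly_op_bound_degree:
  assumes "degree p \<le> n"
  shows "poly_op p T x = (\<Sum>i\<le>n. coeff p i *s (T ^^ i) x)"
  unfolding poly_op_def using assms by (intro sum.mono_neutral_left) (auto simp: coeff_eq_0)

lemma poly_op_pCons: "poly_op (pCons a p) T x = a *s x + poly_op p T (T x)"
proof -
  have "poly_op (pCons a p) T x = (\<Sum>i\<le>Suc (degree p). coeff (pCons a p) i *s (T ^^ i) x)"
    by (rule poly_op_bound_degree) (simp add: degree_pCons_le)
  also have "\<dots> = a *s x + (\<Sum>i\<le>degree p. coeff p i *s (T ^^ Suc i) x)"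
    by (subst sum.atMost_Suc_shift) simp
  finally show ?thesis by (simp add: poly_op_def funpow_swap1)
qed

lemma poly_op_add: "poly_op (p + q) T x = poly_op p T x + poly_op q T x"
proof -
  define n where "n = max (degree p) (degree q)"
  have "degree p \<le> n" "degree q \<le> n" "degree (p + q) \<le> n"
    by (auto simp: n_def intro: degree_add_le_max)
  thus ?thesis by (simp add: poly_op_bound_degree sum.distrib vec.scale_left_distrib)
qed

lemma poly_op_smult: "poly_op (smult c p) T x = c *s poly_op p T x"
  by (subst poly_op_bound_degree[of _ "degree p"])
    (simp_all add: degree_smult_le poly_op_def vec.scale_sum_right)

lemma poly_op_diff: "poly_op (p - q) T x = poly_op p T x - poly_op q T x"
  using poly_op_add[of "p - q" q T x] by simp

abbreviation clinear :: "(complex^'n \<Rightarrow> complex^'n) \<Rightarrow> bool" where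
  "clinear \<equiv> Vector_Spaces.linear (*s) (*s)"

lemma poly_op_add_vec:
  assumes "clinear T" shows "poly_op p T (x + y) = poly_op p T x + poly_op p T y"
  using assms
  by (induction p arbitrary: x y) (simp_all add: poly_op_pCons vec.linear_add vec.scale_right_distrib)

lemma poly_op_scale_vec:
  assumes "clinear T" shows "poly_op p T (c *s x) = c *s poly_op p T x"
  using assms
  by (induction p arbitrary: x) (simp_all add: poly_op_pCons vec.linear_scale vec.scale_right_distrib mult.commute)

lemma poly_op_diff_vec:
  assumes "clinear T" shows "poly_op p T (x - y) = poly_op p T x - poly_op p T y"
  using poly_op_add_vec[OF assms, of p x "(-1) *s y"] poly_op_scale_vec[OF assms, of p "-1" y] by simp

lemma poly_op_zero_vec: assumes "clinear T" shows "poly_op p T 0 = 0"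
  using poly_op_diff_vec[OF assms, of p 0 0] by simp

lemma poly_op_commute: 
  assumes "clinear T" shows "T (poly_op p T x) = poly_op p T (T x)"
  using assms by (induction p arbitrary: x)
    (simp_all add: poly_op_pCons vec.linear_add vec.linear_scale vec.linear_0)

lemma poly_op_mult:
  assumes "clinear T" shows "poly_op (p * q) T x = poly_op p T (poly_op q T x)"
  using assms by (induction p arbitrary: x)
    (simp_all add: mult_pCons_left poly_op_add poly_op_smult poly_op_pCons poly_op_commute)

lemma poly_op_eigenvector:
  assumes "clinear T" "T x = a *s x" shows "poly_op p T x = poly p a *s x"
  by (induction p) (simp_all add: poly_op_pCons assms poly_op_scale_vec vec.scale_left_distrib mult.commute)

lemma poly_op_linear_factor: "poly_op [:-a, 1:] T x = T x - a *s x"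
  by (simp add: poly_op_pCons)

lemma poly_op_in_subspace:
  assumes "vec.subspace V" "T ` V \<subseteq> V" "x \<in> V" shows "poly_op p T x \<in> V"
  using assms(3)
proof (induction p arbitrary: x)
  case (pCons a p)
  have "T x \<in> V" using assms(2) pCons.prems by auto
  thus ?case using pCons assms(1) by (simp add: poly_op_pCons vec.subspace_add vec.subspace_scale)
qed (use assms(1) in \<open>simp add: vec.subspace_0\<close>)

lemma exists_annihilating_poly:
  fixes T :: "complex^'n \<Rightarrow> complex^'n" and x :: "complex^'n"
  shows "\<exists>p. p \<noteq> 0 \<and> poly_op p T x = 0"
proof -
  define f where "f = (\<lambda>i. (T ^^ i) x)"
  \<comment> \<open>Dependence is a property of sets, so a repetition among the n + 1 iterates is
    treated apart: it yields a difference of monomials.\<close>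
  show ?thesis
  proof (cases "inj_on f {..CARD('n)}")
    case False
    then obtain i j where ij: "i \<noteq> j" "f i = f j" by (auto simp: inj_on_def)
    define p :: "complex poly" where "p = monom 1 i - monom 1 j"
    have "poly_op (monom 1 k) T x = f k" for k
      by (subst poly_op_bound_degree[of _ k])
        (simp_all add: degree_monom_le f_def if_distrib[of "\<lambda>c. c *s _"] cong: if_cong)
    hence "poly_op p T x = 0" using ij by (simp add: p_def poly_op_diff)
    moreover have "coeff p i \<noteq> 0" using ij by (simp add: p_def)
    hence "p \<noteq> 0" by auto
    ultimately show ?thesis by blast
  next
    case True
    have "vec.dependent (f ` {..CARD('n)})"
    proof (rule ccontr)
      assume "vec.independent (f ` {..CARD('n)})"
      from vec.independent_card_le_dim[OF subset_UNIV this] True show False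
        by (simp add: card_image card_cart_basis)
    qed
    then obtain u where u: "\<exists>v\<in>f ` {..CARD('n)}. u v \<noteq> 0" "(\<Sum>v\<in>f ` {..CARD('n)}. u v *s v) = 0"
      by (subst (asm) vec.dependent_finite) auto
    define p where "p = Poly (map (\<lambda>i. u (f i)) [0..<Suc CARD('n)])"
    have c: "coeff p i = (if i \<le> CARD('n) then u (f i) else 0)" for i
      by (simp add: p_def nth_default_def less_Suc_eq_le del: upt_Suc)
    have "degree p \<le> CARD('n)" by (rule degree_le) (simp add: c)
    hence "poly_op p T x = (\<Sum>i\<le>CARD('n). u (f i) *s f i)"
      by (simp add: poly_op_bound_degree c f_def)
    also have "\<dots> = 0" using u(2) by (simp add: sum.reindex[OF True])
    finally have "poly_op p T x = 0" .
    moreover from u(1) obtain i where "i \<le> CARD('n)" "u (f i) \<noteq> 0" by auto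
    hence "coeff p i \<noteq> 0" by (simp add: c)
    hence "p \<noteq> 0" by auto
    ultimately show ?thesis by blast
  qed
qed

lemma poly_root_factor:
  fixes p :: "complex poly"
  assumes "degree p \<noteq> 0"
  obtains a q where "p = [:-a, 1:] * q" "degree q < degree p" "q \<noteq> 0"
proof -
  have "\<exists>a. poly p a = 0"
    using assms by (intro alg_closed_imp_poly_has_root) simp
  then obtain a q where pq: "p = [:-a, 1:] * q" by (auto simp: poly_eq_0_iff_dvd dvd_def)
  moreover have "q \<noteq> 0" using assms pq by auto
  moreover have "degree p = Suc (degree q)" using pq \<open>q \<noteq> 0\<close> by (simp add: degree_mult_eq del: mult_pCons_left)
  ultimately show ?thesis using that by auto
qed

text \<open>Linear factors are removed from a polynomial annihilating \<open>x\<close> until the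
  quotient no longer does; its value at \<open>x\<close> is then an eigenvector, and it stays in the
  invariant space \<open>V\<close>.\<close>

lemma exists_eigenvector_in_subspace:
  assumes T: "clinear T" and V: "vec.subspace V" "T ` V \<subseteq> V" "x \<in> V" "x \<noteq> 0"
  obtains a y where "y \<in> V" "norm y = 1" "T y = a *s y"
proof -
  obtain p where "p \<noteq> 0" "poly_op p T x = 0" using exists_annihilating_poly by blast
  hence "\<exists>a y. y \<in> V \<and> y \<noteq> 0 \<and> T y = a *s y"
  proof (induction "degree p" arbitrary: p rule: less_induct)
    case less
    show ?case
    proof (cases "degree p = 0")
      case True
      then obtain c where "p = [:c:]" by (rule degree_eq_zeroE)
      with less.prems V(4) show ?thesis by (simp add: poly_op_pCons)
    next
      case False
      then obtain a q where q: "p = [:-a, 1:] * q" "degree q < degree p" "q \<noteq> 0"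
        by (rule poly_root_factor)
      show ?thesis
      proof (cases "poly_op q T x = 0")
        case False
        moreover have "poly_op q T x \<in> V" using V by (intro poly_op_in_subspace)
        moreover have "T (poly_op q T x) = a *s poly_op q T x"
          using less.prems(2) unfolding q(1) poly_op_mult[OF T] poly_op_linear_factor by simp
        ultimately show ?thesis by blast
      qed (use less.hyps q in blast)
    qed
  qed
  then obtain a y where y: "y \<in> V" "y \<noteq> 0" "T y = a *s y" by blast
  define z where "z = of_real (1 / norm y) *s y"
  have "z \<in> V" using y V by (simp add: z_def vec.subspace_scale)
  moreover have "norm z = 1" using y by (simp add: z_def norm_vector_scale norm_divide)
  moreover have "T z = a *s z" using y T by (simp add: z_def vec.linear_scale mult.commute)
  ultimately show ?thesis using that by blast
qed

section \<open>Operators on two-dimensional spaces\<close>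

lemma poly_op_upper_triangular:
  fixes a b c :: complex
  assumes T: "clinear T" and e1: "T e1 = a *s e1" and e2: "T e2 = c *s e1 + b *s e2"
  shows "poly_op p T e2 =
    (c * (if a = b then poly (pderiv p) a else (poly p a - poly p b) / (a - b))) *s e1 + poly p b *s e2"
proof (cases "a = b")
  case True
  have "poly_op p T e2 = (c * poly (pderiv p) a) *s e1 + poly p a *s e2"
  proof (induction p)
    case (pCons k p)
    have "poly_op (pCons k p) T e2 = k *s e2 + (c *s poly_op p T e1 + a *s poly_op p T e2)"
      using True by (simp add: poly_op_pCons e2 poly_op_add_vec[OF T] poly_op_scale_vec[OF T])
    thus ?case
      by (simp add: pCons.IH poly_op_eigenvector[OF T e1] pderiv_pCons vec.scale_left_distrib
          vec.scale_right_distrib algebra_simps)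
  qed simp
  thus ?thesis using True by simp
next
  case False
  \<comment> \<open>With this \<open>k\<close> the vector e2 + k e1 is an eigenvector for
    \<open>b\<close>, so \<open>T\<close> is diagonal in the basis e1, v.\<close>
  define k where "k = c / (b - a)"
  define v where "v = e2 + k *s e1"
  have k: "c + k * a = b * k" using False by (simp add: k_def field_simps)
  have "T v = (c + k * a) *s e1 + b *s e2"
    by (simp add: v_def vec.linear_add[OF T] vec.linear_scale[OF T] e1 e2 vec.scale_left_distrib)
  hence Tv: "T v = b *s v" by (simp add: k v_def vec.scale_right_distrib)
  have "poly_op p T e2 = poly_op p T (v - k *s e1)" by (simp add: v_def)
  also have "\<dots> = poly p b *s v - (k * poly p a) *s e1"
    by (simp add: poly_op_diff_vec[OF T] poly_op_scale_vec[OF T] poly_op_eigenvector[OF T e1]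
        poly_op_eigenvector[OF T Tv])
  also have "\<dots> = (k * (poly p b - poly p a)) *s e1 + poly p b *s e2"
    by (simp add: v_def vec.scale_right_distrib vec.scale_left_diff_distrib algebra_simps)
  also have "k * (poly p b - poly p a) = c * ((poly p a - poly p b) / (a - b))"
    using False by (simp add: k_def field_simps)
  finally show ?thesis using False by simp
qed

text \<open>The coordinates (x, \<eta>) of a unit vector with real x give a point of the sphere by u
  = x^2 - |\<eta>|^2 and \<zeta> = 2 x \<eta> (the Hopf map); this map is inverted here. At u = -1
  the division by x fails, but there \<zeta> = 0.\<close>

lemma triangular_numerical_range:
  fixes a b c :: complex and \<zeta> :: complex and u :: real
  assumes T: "clinear T" and e1: "T e1 = a *s e1" and e2: "T e2 = c *s e1 + b *s e2"
    and on: "norm e1 = 1" "norm e2 = 1" "cinner e1 e2 = 0" and u: "u\<^sup>2 + (cmod \<zeta>)\<^sup>2 = 1"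
  obtains \<xi> \<eta> where "norm (\<xi> *s e1 + \<eta> *s e2) = 1"
    "cinner (T (\<xi> *s e1 + \<eta> *s e2)) (\<xi> *s e1 + \<eta> *s e2)
      = a * of_real ((1 + u) / 2) + b * of_real ((1 - u) / 2) + c * \<zeta> / 2"
proof -
  have u1: "- 1 \<le> u" "u \<le> 1"
  proof -
    have "u\<^sup>2 \<le> 1" using u zero_le_power2[of "cmod \<zeta>"] by linarith
    thus "- 1 \<le> u" "u \<le> 1" by (simp_all add: abs_square_le_1 abs_le_iff)
  qed
  obtain x :: real and \<eta> where x: "x\<^sup>2 = (1 + u) / 2" "(cmod \<eta>)\<^sup>2 = (1 - u) / 2" "of_real x * \<eta> = \<zeta> / 2"
  proof (cases "u = -1")
    case True
    thus ?thesis using that[of 0 1] u by simp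
  next
    case False
    define x where "x = sqrt ((1 + u) / 2)"
    have x: "x\<^sup>2 = (1 + u) / 2" "x > 0" using u1 False by (auto simp: x_def)
    have "(cmod (\<zeta> / (2 * of_real x)))\<^sup>2 = (1 - u\<^sup>2) / (4 * x\<^sup>2)"
      using u by (simp add: norm_divide norm_mult power_divide power_mult_distrib)
    also have "\<dots> = (1 - u) / 2"
      unfolding x(1) using False u1 by (simp add: power2_eq_square field_simps)
    finally show ?thesis using that[of x "\<zeta> / (2 * of_real x)"] x by simp
  qed
  define z where "z = of_real x *s e1 + \<eta> *s e2"
  have self: "cinner e1 e1 = 1" "cinner e2 e2 = 1" "cinner e2 e1 = 0"
    using on cinner_commute[of e2 e1] by (auto simp: cinner_self)
  have etaeta: "\<eta> * cnj \<eta> = of_real ((1 - u) / 2)"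
    unfolding x(2)[symmetric] by (rule complex_norm_square[symmetric])
  have xx: "complex_of_real x * of_real x = of_real ((1 + u) / 2)"
    unfolding x(1)[symmetric] by (simp add: power2_eq_square)
  have "cinner z z = of_real x * of_real x + \<eta> * cnj \<eta>"
    unfolding z_def by (simp add: cinner_add_left cinner_add_right cinner_scale_left cinner_scale_right self on)
  also have "\<dots> = of_real ((1 + u) / 2 + (1 - u) / 2)" unfolding xx etaeta by (simp only: of_real_add)
  also have "(1 + u) / 2 + (1 - u) / 2 = 1" by (simp add: field_simps)
  finally have "norm z = 1" by (simp flip: cinner_self_eq_1)
  have "T z = (a * of_real x + c * \<eta>) *s e1 + (b * \<eta>) *s e2"
    by (simp add: z_def vec.linear_add[OF T] vec.linear_scale[OF T] e1 e2 vec.scale_right_distrib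
        vec.scale_left_distrib mult.commute)
  hence "cinner (T z) z = (a * of_real x + c * \<eta>) * of_real x + b * \<eta> * cnj \<eta>"
    unfolding z_def by (simp add: cinner_add_left cinner_add_right cinner_scale_left cinner_scale_right self on)
  also have "\<dots> = a * (of_real x * of_real x) + c * (of_real x * \<eta>) + b * (\<eta> * cnj \<eta>)"
    by (simp add: algebra_simps)
  also have "\<dots> = a * of_real ((1 + u) / 2) + b * of_real ((1 - u) / 2) + c * \<zeta> / 2"
    unfolding xx etaeta x(3) by simp
  finally show ?thesis using that \<open>norm z = 1\<close> unfolding z_def by blast
qed

text \<open>Schur's triangular form: a unit eigenvector is completed by Gram-Schmidt to an
  orthonormal basis of \<open>V\<close>. The set \<open>W\<close> is kept separate from
  \<open>T\<close> so that a compression can be measured on the numerical range of the full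
  matrix.\<close>

theorem crouzeix_dim_le_2:
  fixes T :: "complex^'n \<Rightarrow> complex^'n"
  assumes T: "clinear T" and V: "vec.subspace V" "T ` V \<subseteq> V" "vec.dim V \<le> 2"
    and W: "\<And>x. x \<in> V \<Longrightarrow> norm x = 1 \<Longrightarrow> cinner (T x) x \<in> W"
    and M: "\<And>z. z \<in> W \<Longrightarrow> cmod (poly p z) \<le> M"
    and x: "x \<in> V"
  shows "norm (poly_op p T x) \<le> 2 * M * norm x"
proof (cases "x = 0")
  case True
  thus ?thesis by (simp add: poly_op_zero_vec[OF T])
next
  case False
  obtain a e1 where e1: "e1 \<in> V" "norm e1 = 1" "T e1 = a *s e1"
    using exists_eigenvector_in_subspace[OF T V(1,2) x False] by blast
  have self1: "cinner e1 e1 = 1" using e1 by (simp add: cinner_self_eq_1)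
  have "a \<in> W" using W[OF e1(1,2)] by (simp add: e1(3) cinner_scale_left self1)
  hence M0: "0 \<le> M" using M norm_ge_zero order_trans by blast
  show ?thesis
  proof (cases "V \<subseteq> vec.span {e1}")
    case True
    then obtain k where "x = k *s e1" using x by (auto simp: vec.span_singleton)
    hence Tx: "T x = a *s x" by (simp add: vec.linear_scale[OF T] e1(3) mult.commute)
    have "norm (poly_op p T x) = cmod (poly p a) * norm x"
      by (simp add: poly_op_eigenvector[OF T Tx] norm_vector_scale)
    also have "\<dots> \<le> (2 * M) * norm x"
      using M[OF \<open>a \<in> W\<close>] M0 by (intro mult_right_mono) auto
    finally show ?thesis .
  next
    case nspan: False
    then obtain v where v: "v \<in> V" "v \<notin> vec.span {e1}" by blast
    define w where "w = v - cinner v e1 *s e1"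
    have w: "w \<in> V" "cinner w e1 = 0" using v e1 V(1)
      by (auto simp: w_def vec.subspace_diff vec.subspace_scale cinner_diff_left cinner_scale_left self1)
    have w_nspan: "w \<notin> vec.span {e1}"
    proof
      assume w_span: "w \<in> vec.span {e1}"
      have "cinner v e1 *s e1 \<in> vec.span {e1}" by (intro vec.span_scale vec.span_base) simp
      with w_span have "w + cinner v e1 *s e1 \<in> vec.span {e1}" by (rule vec.span_add)
      thus False using v by (simp add: w_def)
    qed
    hence "w \<noteq> 0" using vec.span_zero by metis
    define e2 where "e2 = of_real (1 / norm w) *s w"
    have e2: "e2 \<in> V" "norm e2 = 1" "cinner e2 e1 = 0" using w \<open>w \<noteq> 0\<close> V(1)
      by (auto simp: e2_def vec.subspace_scale norm_vector_scale norm_divide cinner_scale_left)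
    have e12: "cinner e1 e2 = 0" using e2(3) cinner_commute[of e1 e2] by simp
    have e2_nspan: "e2 \<notin> vec.span {e1}"
    proof
      assume "e2 \<in> vec.span {e1}"
      hence "of_real (norm w) *s e2 \<in> vec.span {e1}" by (rule vec.span_scale)
      thus False using w_nspan \<open>w \<noteq> 0\<close> by (simp add: e2_def)
    qed
    have "e1 \<noteq> 0" using e1(2) by auto
    hence "vec.independent {e2, e1}" using e2_nspan by (intro vec.independent_insertI) (auto simp: vec.independent_empty)
    moreover have "e2 \<noteq> e1" using e2_nspan vec.span_base by blast
    hence "card {e2, e1} = 2" by simp
    ultimately have "V \<subseteq> vec.span {e2, e1}"
      using V(3) e1 e2 by (intro vec.card_ge_dim_independent) auto
    have rep: "\<exists>k1 k2. y = k1 *s e1 + k2 *s e2" if "y \<in> V" for y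
    proof -
      have "y \<in> vec.span {e2, e1}" using that \<open>V \<subseteq> _\<close> by blast
      then obtain k2 where "y - k2 *s e2 \<in> vec.span {e1}" by (auto simp: vec.span_insert[of e2])
      then obtain k1 where "y - k2 *s e2 = k1 *s e1" by (auto simp: vec.span_singleton)
      hence "y = k1 *s e1 + k2 *s e2" by (simp add: diff_eq_eq)
      thus ?thesis by blast
    qed
    have "T e2 \<in> V" using V(2) e2 by auto
    then obtain c b where Te2: "T e2 = c *s e1 + b *s e2" using rep by blast
    obtain \<xi> \<eta> where x_eq: "x = \<xi> *s e1 + \<eta> *s e2" using rep[OF x] by blast
    have nrm: "(norm (k1 *s e1 + k2 *s e2))\<^sup>2 = (cmod k1)\<^sup>2 + (cmod k2)\<^sup>2" for k1 k2
      by (subst cinner_eq_0_imp_norm_add)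
        (simp_all add: cinner_scale_left cinner_scale_right e12 norm_vector_scale e1 e2)
    define d where "d = (\<lambda>q. if a = b then poly (pderiv q) a else (poly q a - poly q b) / (a - b))"
    \<comment> \<open>Scaling by some N > M makes the polynomial strictly smaller than 1 on
      \<open>W\<close>, as the Schwarz lemma demands; afterwards N tends to M.\<close>
    have bound: "norm (poly_op p T x) \<le> 2 * N * norm x" if "M < N" for N
    proof -
      have N: "N > 0" using that M0 by simp
      define q where "q = smult (of_real (1 / N)) p"
      have "(cmod (poly q a))\<^sup>2 + (cmod (poly q b))\<^sup>2 + (cmod (c * d q))\<^sup>2
          \<le> 4 + (cmod (poly q a))\<^sup>2 * (cmod (poly q b))\<^sup>2 / 4" unfolding d_def
      proof (rule crouzeix_triangular_entries)
        show "M / N < 1" using that N by simp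
        fix u \<zeta> assume "u\<^sup>2 + (cmod \<zeta>)\<^sup>2 = 1"
        from triangular_numerical_range[OF T e1(3) Te2 e1(2) e2(2) e12 this]
        obtain \<xi>' \<eta>' where z: "norm (\<xi>' *s e1 + \<eta>' *s e2) = 1"
          "cinner (T (\<xi>' *s e1 + \<eta>' *s e2)) (\<xi>' *s e1 + \<eta>' *s e2)
            = a * of_real ((1 + u) / 2) + b * of_real ((1 - u) / 2) + c * \<zeta> / 2" .
        have "\<xi>' *s e1 + \<eta>' *s e2 \<in> V"
          using V(1) e1 e2 by (intro vec.subspace_add vec.subspace_scale)
        from W[OF this z(1)] M N
        show "cmod (poly q (a * of_real ((1 + u) / 2) + b * of_real ((1 - u) / 2) + c * \<zeta> / 2)) \<le> M / N"
          unfolding z(2) by (simp add: q_def norm_mult norm_divide divide_right_mono)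
      qed
      moreover have "cmod (poly q a) \<le> 1"
        using M[OF \<open>a \<in> W\<close>] that N by (simp add: q_def norm_mult norm_divide)
      ultimately have "(cmod (poly q a * \<xi> + (c * d q) * \<eta>))\<^sup>2 + (cmod (poly q b * \<eta>))\<^sup>2
          \<le> 4 * ((cmod \<xi>)\<^sup>2 + (cmod \<eta>)\<^sup>2)" by (rule upper_triangular_norm_le_2)
      also have "(cmod (poly q a * \<xi> + (c * d q) * \<eta>))\<^sup>2 + (cmod (poly q b * \<eta>))\<^sup>2
          = (norm (poly_op q T x))\<^sup>2"
      proof -
        have "poly_op q T x = \<xi> *s (poly q a *s e1) + \<eta> *s ((c * d q) *s e1 + poly q b *s e2)"
          unfolding x_eq poly_op_add_vec[OF T] poly_op_scale_vec[OF T] poly_op_eigenvector[OF T e1(3)]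
            poly_op_upper_triangular[OF T e1(3) Te2] d_def ..
        also have "\<dots> = (poly q a * \<xi> + (c * d q) * \<eta>) *s e1 + (poly q b * \<eta>) *s e2"
          by (simp add: vec.scale_right_distrib vec.scale_left_distrib mult_ac)
        finally show ?thesis by (simp only: nrm)
      qed
      also have "4 * ((cmod \<xi>)\<^sup>2 + (cmod \<eta>)\<^sup>2) = (2 * norm x)\<^sup>2"
        unfolding power_mult_distrib x_eq nrm by simp
      finally have "norm (poly_op q T x) \<le> 2 * norm x" by (rule power2_le_imp_le) simp
      thus ?thesis using N by (simp add: q_def poly_op_smult norm_vector_scale norm_divide field_simps)
    qed
    show ?thesis
    proof (rule field_le_epsilon)
      fix e :: real assume "0 < e"
      have "x \<noteq> 0" by (rule False)
      have "norm (poly_op p T x) \<le> 2 * (M + e / (2 * norm x)) * norm x"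
        using \<open>0 < e\<close> \<open>x \<noteq> 0\<close> by (intro bound) simp
      also have "\<dots> = 2 * M * norm x + e" using \<open>x \<noteq> 0\<close> by (simp add: field_simps)
      finally show "norm (poly_op p T x) \<le> 2 * M * norm x + e" .
    qed
  qed
qed


text \<open>A Jordan chain of length two spans an invariant plane on which \<open>T\<close> is
  triangular with double eigenvalue a and off-diagonal entry c > 0. The numerical range of that
  block contains the disc of radius c/2 about a.\<close>

lemma defective_eigenvalue_in_interior:
  assumes T: "clinear T" and W: "\<And>x. norm x = 1 \<Longrightarrow> cinner (T x) x \<in> W"
    and w: "w \<noteq> 0" "T w = a *s w" and v: "T v = a *s v + w"
  shows "a \<in> interior W"
proof -
  define k where "k = cinner v w / of_real ((norm w)\<^sup>2)"
  define v' where "v' = v - k *s w"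
  have Tv': "T v' = a *s v' + w"
    by (simp add: v'_def vec.linear_diff[OF T] vec.linear_scale[OF T] w v vec.scale_right_diff_distrib mult.commute)
  have orth: "cinner v' w = 0"
    using w(1) by (simp add: v'_def cinner_diff_left cinner_scale_left cinner_self k_def)
  have "v' \<noteq> 0" using Tv' w(1) vec.linear_0[OF T] by auto
  define e1 where "e1 = of_real (1 / norm w) *s w"
  define e2 where "e2 = of_real (1 / norm v') *s v'"
  define c where "c = norm w / norm v'"
  have c: "c > 0" using w(1) \<open>v' \<noteq> 0\<close> by (simp add: c_def)
  have on: "norm e1 = 1" "norm e2 = 1" "cinner e1 e2 = 0"
    using w(1) \<open>v' \<noteq> 0\<close> orth cinner_commute[of w v']
    by (auto simp: e1_def e2_def norm_vector_scale norm_divide cinner_scale_left cinner_scale_right)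
  have Te1: "T e1 = a *s e1" by (simp add: e1_def vec.linear_scale[OF T] w(2) mult.commute)
  have Te2: "T e2 = of_real c *s e1 + a *s e2"
    using w(1) by (simp add: e1_def e2_def c_def vec.linear_scale[OF T] Tv' vec.scale_right_distrib mult.commute)
  have "ball a (c / 2) \<subseteq> W"
  proof
    fix z assume z: "z \<in> ball a (c / 2)"
    define \<zeta> where "\<zeta> = 2 / of_real c * (z - a)"
    define u where "u = sqrt (1 - (cmod \<zeta>)\<^sup>2)"
    have "cmod \<zeta> = 2 / c * cmod (z - a)" 
      unfolding \<zeta>_def norm_mult using c by (simp add: norm_divide)
    also have "\<dots> < 1" using z c by (simp add: dist_norm norm_minus_commute divide_less_eq)
    finally have "cmod \<zeta> < 1" .
    hence "u\<^sup>2 + (cmod \<zeta>)\<^sup>2 = 1" by (simp add: u_def power_le_one)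
    from triangular_numerical_range[OF T Te1 Te2 on this]
    have "a * of_real ((1 + u) / 2) + a * of_real ((1 - u) / 2) + of_real c * \<zeta> / 2 \<in> W"
      using W by metis
    also have "a * of_real ((1 + u) / 2) + a * of_real ((1 - u) / 2) + of_real c * \<zeta> / 2 = z"
      using c by (simp add: \<zeta>_def field_simps)
    finally show "z \<in> W" .
  qed
  thus ?thesis using c by (meson centre_in_ball half_gt_zero interior_maximal open_ball subsetD)
qed

section \<open>Polynomial approximation on convex sets\<close>

definition poly_approximable :: "complex set \<Rightarrow> (complex \<Rightarrow> complex) \<Rightarrow> bool" where
  "poly_approximable K f \<longleftrightarrow> (\<forall>e>0. \<exists>p. \<forall>z\<in>K. cmod (f z - poly p z) \<le> e)"

lemma poly_approximable_cmult:
  assumes "poly_approximable K f"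
  shows "poly_approximable K (\<lambda>z. c * f z)"
  unfolding poly_approximable_def
proof (intro allI impI)
  fix e :: real assume "e > 0"
  hence "e / (cmod c + 1) > 0" by (simp add: add_nonneg_pos)
  then obtain p where p: "\<And>z. z \<in> K \<Longrightarrow> cmod (f z - poly p z) \<le> e / (cmod c + 1)"
    using assms unfolding poly_approximable_def by blast
  have "cmod (c * f z - poly (smult c p) z) \<le> e" if "z \<in> K" for z
  proof -
    have "cmod (c * f z - poly (smult c p) z) = cmod c * cmod (f z - poly p z)"
      by (simp flip: norm_mult add: right_diff_distrib)
    also have "\<dots> \<le> (cmod c + 1) * (e / (cmod c + 1))"
      using p[OF that] by (intro mult_mono) auto
    also have "\<dots> = e" by (simp add: add_nonneg_pos less_imp_neq[symmetric])
    finally show ?thesis .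
  qed
  thus "\<exists>p. \<forall>z\<in>K. cmod (c * f z - poly p z) \<le> e" by blast
qed

lemma poly_approximable_uniform:
  assumes "\<And>e. e > 0 \<Longrightarrow> \<exists>g. poly_approximable K g \<and> (\<forall>z\<in>K. cmod (f z - g z) \<le> e)"
  shows "poly_approximable K f"
  unfolding poly_approximable_def
proof (intro allI impI)
  fix e :: real assume "e > 0"
  then obtain g where g: "poly_approximable K g" "\<And>z. z \<in> K \<Longrightarrow> cmod (f z - g z) \<le> e / 2"
    using assms[of "e / 2"] by auto
  then obtain p where p: "\<And>z. z \<in> K \<Longrightarrow> cmod (g z - poly p z) \<le> e / 2"
    using \<open>e > 0\<close> unfolding poly_approximable_def by (metis half_gt_zero)
  have "cmod (f z - poly p z) \<le> e" if "z \<in> K" for z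
    using norm_diff_triangle_le[OF g(2)[OF that] p[OF that]] by simp
  thus "\<exists>p. \<forall>z\<in>K. cmod (f z - poly p z) \<le> e" by blast
qed

lemma poly_approximable_uniform_limit:
  assumes "poly_approximable K f"
  obtains p where "uniform_limit K (\<lambda>k. poly (p k)) f sequentially"
proof -
  have "\<forall>k. \<exists>p. \<forall>z\<in>K. cmod (f z - poly p z) \<le> inverse (real (Suc k))"
    using assms unfolding poly_approximable_def by simp
  then obtain p where p: "\<And>k z. z \<in> K \<Longrightarrow> cmod (f z - poly (p k) z) \<le> inverse (real (Suc k))"
    by metis
  have "uniform_limit K (\<lambda>k. poly (p k)) f sequentially"
  proof (rule uniform_limitI)
    fix e :: real assume "e > 0"
    hence "eventually (\<lambda>k. inverse (real (Suc k)) < e) sequentially"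
      using LIMSEQ_inverse_real_of_nat order_tendstoD(2) by blast
    thus "\<forall>\<^sub>F k in sequentially. \<forall>z\<in>K. dist (poly (p k) z) (f z) < e"
    proof eventually_elim
      case (elim k)
      thus ?case using p[of _ k] by (metis dist_commute dist_norm le_less_trans)
    qed
  qed
  thus ?thesis by (rule that)
qed

text \<open>\<open>K\<close> lies in a large disc that avoids \<open>w\<close>; expand the kernel in powers about its centre.\<close>

lemma cauchy_kernel_poly_approximable:
  fixes w :: complex
  assumes K: "compact K" "convex K" "K \<noteq> {}" and w: "w \<notin> K"
  shows "poly_approximable K (\<lambda>z. 1 / (w - z))"
proof -
  define m where "m = closest_point K w"
  have m: "m \<in> K" unfolding m_def using K by (intro closest_point_in_set compact_imp_closed)
  define \<delta> where "\<delta> = cmod (w - m)"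
  have \<delta>: "\<delta> > 0" using m w by (auto simp: \<delta>_def)
  have far: "\<delta> \<le> cmod (w - z)" if "z \<in> K" for z
    using closest_point_le[OF compact_imp_closed[OF K(1)] that, of w] by (simp add: \<delta>_def m_def dist_norm)
  obtain D where D: "\<And>z. z \<in> K \<Longrightarrow> dist m z \<le> D"
    using K(1) m compact_imp_bounded bounded_any_center[of K m] by blast
  have D0: "0 \<le> D" using D[OF m] by simp
  \<comment> \<open>Large enough for D^2 \<le> R \<delta>, whence D^2 + R^2 < (R + \<delta>)^2. The
    centre \<open>c\<close> lies at distance \<open>R\<close> from \<open>m\<close> on the side away
    from \<open>w\<close>; the obtuse angle at \<open>m\<close> puts \<open>K\<close> within sqrt
    (D^2 + R^2) of it.\<close>
  define R where "R = D\<^sup>2 / \<delta> + 1"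
  have R: "R > 0" using \<delta> by (auto simp: R_def intro: add_nonneg_pos)
  define n where "n = (w - m) / of_real \<delta>"
  have n: "cmod n = 1" using \<delta> by (simp add: n_def norm_divide \<delta>_def)
  define c where "c = m - of_real R * n"
  have wc: "cmod (w - c) = R + \<delta>"
  proof -
    have "w - m = of_real \<delta> * n" using \<delta> by (simp add: n_def)
    hence "w - c = of_real (R + \<delta>) * n" by (simp add: c_def algebra_simps)
    thus ?thesis using n R \<delta> by (simp only: norm_mult norm_of_real) simp
  qed
  define q where "q = sqrt (D\<^sup>2 + R\<^sup>2) / (R + \<delta>)"
  have "D\<^sup>2 + R\<^sup>2 < (R + \<delta>)\<^sup>2"
  proof -
    have "D\<^sup>2 \<le> R * \<delta>" using \<delta> by (simp add: R_def algebra_simps)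
    moreover have "R * \<delta> > 0" "\<delta>\<^sup>2 > 0" using R \<delta> by simp_all
    moreover have "(R + \<delta>)\<^sup>2 = R\<^sup>2 + 2 * (R * \<delta>) + \<delta>\<^sup>2" by (simp add: power2_sum)
    ultimately show ?thesis by linarith
  qed
  hence "sqrt (D\<^sup>2 + R\<^sup>2) < R + \<delta>" using R \<delta> by (simp add: real_less_lsqrt)
  hence q: "0 \<le> q" "q < 1" using R \<delta> by (auto simp: q_def)
  have ratio: "cmod (z - c) \<le> q * cmod (w - c)" if z: "z \<in> K" for z
  proof -
    have "inner (w - m) (z - m) \<le> 0"
      unfolding m_def using closest_point_dot[OF K(2) compact_imp_closed[OF K(1)] z] .
    moreover have "n = (1 / \<delta>) *\<^sub>R (w - m)" by (simp add: n_def scaleR_conv_of_real field_simps)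
    ultimately have "inner n (z - m) \<le> 0" using \<delta> by (simp add: mult_nonneg_nonpos divide_nonpos_pos)
    moreover have "(cmod (v + R *\<^sub>R n))\<^sup>2 = (cmod v)\<^sup>2 + 2 * R * inner n v + R\<^sup>2 * (cmod n)\<^sup>2" for v
      unfolding power2_norm_eq_inner
      by (simp add: inner_add_left inner_add_right inner_commute[of v n] power2_eq_square distrib_left)
    from this[of "z - m"] have "(cmod (z - c))\<^sup>2 = (cmod (z - m))\<^sup>2 + 2 * R * inner n (z - m) + R\<^sup>2"
      by (simp add: n c_def scaleR_conv_of_real algebra_simps)
    moreover have "(cmod (z - m))\<^sup>2 \<le> D\<^sup>2"
      using D[OF z] by (intro power_mono) (auto simp: dist_norm norm_minus_commute)
    ultimately have "(cmod (z - c))\<^sup>2 \<le> D\<^sup>2 + R\<^sup>2"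
      using R by (smt (verit) mult_nonneg_nonpos)
    hence "cmod (z - c) \<le> sqrt (D\<^sup>2 + R\<^sup>2)" by (rule real_le_rsqrt)
    thus ?thesis using R \<delta> by (simp add: q_def wc)
  qed
  show ?thesis unfolding poly_approximable_def
  proof (intro allI impI)
    fix e :: real assume "e > 0"
    then obtain N where N: "q ^ N < e * \<delta>"
      using real_arch_pow_inv[of "e * \<delta>" q] q \<delta> by auto
    define W where "W = w - c"
    have W: "W \<noteq> 0" using wc R \<delta> by (auto simp: W_def)
    \<comment> \<open>A partial sum of the geometric series for 1 / (W (1 - r)) with r = (z - c) /
      W.\<close>
    define p where "p = (\<Sum>i<N. smult (1 / W ^ Suc i) ([:-c, 1:] ^ i))"
    have "cmod (1 / (w - z) - poly p z) \<le> e" if z: "z \<in> K" for z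
    proof -
      define r where "r = (z - c) / W"
      have wz: "w - z = W * (1 - r)" using W by (simp add: r_def W_def field_simps)
      have wz0: "w - z \<noteq> 0" using far[OF z] \<delta> by auto
      hence r1: "r \<noteq> 1" unfolding wz by auto
      have "poly p z = (\<Sum>i<N. r ^ i) / W"
        unfolding p_def poly_sum sum_divide_distrib r_def
        by (intro sum.cong) (simp_all add: poly_power power_divide)
      also have "(\<Sum>i<N. r ^ i) = (1 - r ^ N) / (1 - r)"
        using r1 by (simp add: sum_gp_strict)
      finally have "1 / (w - z) - poly p z = r ^ N / (w - z)"
        unfolding wz using r1 W by (simp add: diff_divide_distrib)
      hence "cmod (1 / (w - z) - poly p z) = cmod r ^ N / cmod (w - z)"
        by (simp add: norm_divide norm_power)
      also have "\<dots> \<le> q ^ N / \<delta>"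
      proof (intro frac_le power_mono)
        show "cmod r \<le> q" using ratio[OF z] W by (simp add: r_def norm_divide W_def[symmetric] divide_le_eq)
      qed (use far[OF z] \<delta> q in auto)
      also have "\<dots> \<le> e" using N \<delta> by (simp add: divide_le_eq)
      finally show ?thesis .
    qed
    thus "\<exists>p. \<forall>z\<in>K. cmod (1 / (w - z) - poly p z) \<le> e" by blast
  qed
qed

text \<open>Push a large circle radially (along the nearest-point projection) onto a parallel curve of \<open>K\<close>.\<close>

lemma convex_surrounding_path:
  fixes K U :: "complex set"
  assumes K: "compact K" "convex K" "K \<noteq> {}" and U: "open U" "K \<subseteq> U"
  obtains h where "polynomial_function h" "pathfinish h = pathstart h" "path_image h \<subseteq> U - K"
    "\<And>z. z \<in> K \<Longrightarrow> winding_number h z = 1"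
proof -
  have cl: "closed K" using K(1) by (rule compact_imp_closed)
  obtain \<eta> where \<eta>: "\<eta> > 0" "(\<Union>x\<in>K. cball x \<eta>) \<subseteq> U"
    using compact_subset_open_imp_cball_epsilon_subset[OF K(1) U] .
  obtain R where R: "R > 0" "K \<subseteq> ball 0 R"
    using compact_imp_bounded[OF K(1)] bounded_subset_ballD[of K 0] by blast
  define c where "c = circlepath 0 R"
  define \<pi>' where "\<pi>' = (\<lambda>t. closest_point K (c t))"
  define l where "l = (\<lambda>t. cmod (c t - \<pi>' t))"
  have piK: "\<pi>' t \<in> K" for t unfolding \<pi>'_def using cl K(3) by (rule closest_point_in_set)
  have nc: "cmod (c t) = R" for t using R by (simp add: c_def circlepath norm_mult)
  hence cK: "c t \<notin> K" for t using R(2) by (metis less_irrefl mem_ball_0 subsetD)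
  have l: "l t > 0" for t using piK[of t] cK[of t] by (auto simp: l_def)
  hence l0: "l t \<noteq> 0" for t by (metis less_irrefl)
  have ray: "\<pi>' t + r *\<^sub>R (c t - \<pi>' t) \<notin> K" if "r > 0" for r t
  proof
    assume "\<pi>' t + r *\<^sub>R (c t - \<pi>' t) \<in> K"
    from closest_point_dot[OF K(2) cl this, of "c t"]
    have "r * (l t)\<^sup>2 \<le> 0" by (simp add: \<pi>'_def l_def power2_norm_eq_inner)
    thus False using that l[of t] by (simp add: mult_le_0_iff)
  qed
  \<comment> \<open>The step outward from the projection has length exactly \<eta>, so the curve
    stays inside \<open>U\<close>.\<close>
  define g where "g = (\<lambda>t. \<pi>' t + (\<eta> / l t) *\<^sub>R (c t - \<pi>' t))"
  have contc: "continuous_on {0..1} c" unfolding c_def by (metis path_circlepath path_def)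
  have contpi: "continuous_on {0..1} \<pi>'" unfolding \<pi>'_def
    by (rule continuous_on_compose2[OF continuous_on_closest_point[OF K(2) cl K(3)] contc]) auto
  have "continuous_on {0..1} l" unfolding l_def by (intro continuous_intros contc contpi)
  hence "path g" unfolding g_def path_def
    using l0 by (intro continuous_intros contc contpi) auto
  have loopg: "pathfinish g = pathstart g" "pathfinish c = pathstart c"
    by (simp_all add: g_def \<pi>'_def l_def pathfinish_def pathstart_def c_def circlepath)
  have gU: "g t \<in> U - K" for t
  proof -
    have "dist (\<pi>' t) (g t) = \<eta>" using l[of t] \<eta> by (simp add: g_def dist_norm l_def)
    hence "g t \<in> U" using \<eta> piK[of t] by (auto simp: mem_cball intro!: subsetD[OF \<eta>(2)] exI)
    thus ?thesis using ray[of "\<eta> / l t" t] \<eta> l[of t] by (simp add: g_def)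
  qed
  have gc: "closed_segment (g t) (c t) \<subseteq> - {z}" if "z \<in> K" for t z
  proof
    fix y assume "y \<in> closed_segment (g t) (c t)"
    then obtain u where u: "0 \<le> u" "u \<le> 1" "y = (1 - u) *\<^sub>R g t + u *\<^sub>R c t"
      by (auto simp: closed_segment_def)
    hence "y = \<pi>' t + ((1 - u) * (\<eta> / l t) + u) *\<^sub>R (c t - \<pi>' t)"
      by (simp add: g_def algebra_simps)
    moreover have "(1 - u) * (\<eta> / l t) + u > 0"
    proof (cases "u = 0")
      case False
      thus ?thesis using u \<eta> l[of t] by (intro add_nonneg_pos mult_nonneg_nonneg) auto
    qed (use \<eta> l[of t] in simp)
    ultimately have "y \<notin> K" using ray by metis
    thus "y \<in> - {z}" using that by auto
  qed
  have "path_image g \<subseteq> U - K" "open (U - K)"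
    using gU U cl by (auto simp: path_image_def)
  then obtain \<epsilon> where \<epsilon>: "\<epsilon> > 0" "(\<Union>x\<in>path_image g. cball x \<epsilon>) \<subseteq> U - K"
    using compact_subset_open_imp_cball_epsilon_subset[OF compact_path_image[OF \<open>path g\<close>]] by metis
  \<comment> \<open>The nearest-point projection is only continuous, whereas contour integration
    needs a differentiable path; a polynomial curve close to \<open>g\<close> has the same winding
    numbers about \<open>K\<close>.\<close>
  obtain h where h: "polynomial_function h" "pathstart h = pathstart g" "pathfinish h = pathfinish g"
    "\<And>t. t \<in> {0..1} \<Longrightarrow> norm (h t - g t) < \<epsilon>"
    using path_approx_polynomial_function[OF \<open>path g\<close> \<epsilon>(1)] by blast
  have hg: "closed_segment (h t) (g t) \<subseteq> U - K" if "t \<in> {0..1}" for t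
  proof -
    have "closed_segment (h t) (g t) \<subseteq> cball (g t) \<epsilon>"
      using h(4)[OF that] \<epsilon>(1)
      by (intro closed_segment_subset convex_cball) (auto simp: dist_norm norm_minus_commute)
    moreover have "cball (g t) \<epsilon> \<subseteq> U - K" using \<epsilon>(2) that unfolding path_image_def by blast
    ultimately show ?thesis by (rule order_trans)
  qed
  have "path h" using h(1) by (rule path_polynomial_function)
  have wn: "winding_number h z = 1" if "z \<in> K" for z
  proof -
    have "winding_number h z = winding_number g z"
      using hg that \<open>path h\<close> \<open>path g\<close> h(2,3) loopg
      by (intro winding_number_homotopic_loops homotopic_loops_linear) auto
    also have "\<dots> = winding_number c z"
      using gc[OF that] \<open>path g\<close> loopg
      by (intro winding_number_homotopic_loops homotopic_loops_linear) (auto simp: c_def)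
    also have "\<dots> = 1" unfolding c_def using R that by (intro winding_number_circlepath) auto
    finally show ?thesis .
  qed
  moreover have "path_image h \<subseteq> U - K" using hg by (fastforce simp: path_image_def)
  ultimately show ?thesis using that[of h] h loopg by auto
qed

text \<open>An error proportional to the length of the interval is additive under subdivision, and
  on short intervals uniform continuity lets the kernel be frozen at one parameter. The Bolzano
  bisection principle joins the two without explicit Riemann sums.\<close>

lemma parametric_integral_poly_approximable:
  fixes k :: "real \<Rightarrow> complex \<Rightarrow> complex"
  assumes K: "compact K" and cont: "continuous_on ({0..1} \<times> K) (\<lambda>(s, z). k s z)"
    and k: "\<And>s. s \<in> {0..1} \<Longrightarrow> poly_approximable K (k s)"
  shows "poly_approximable K (\<lambda>z. integral {0..1} (\<lambda>s. k s z))"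
  unfolding poly_approximable_def
proof (intro allI impI)
  fix e :: real assume e: "e > 0"
  define P where "P = (\<lambda>a b. 0 \<le> a \<longrightarrow> a \<le> b \<longrightarrow> b \<le> 1 \<longrightarrow>
    (\<exists>p. \<forall>z\<in>K. cmod (integral {a..b} (\<lambda>s. k s z) - poly p z) \<le> e * (b - a)))"
  have kz: "continuous_on {a..b} (\<lambda>s. k s z)" if "0 \<le> a" "b \<le> 1" "z \<in> K" for a b z
  proof -
    have 1: "continuous_on {a..b} (\<lambda>s. (s, z))" by (intro continuous_intros)
    have 2: "(\<lambda>s. (s, z)) ` {a..b} \<subseteq> {0..1} \<times> K" using that by auto
    from continuous_on_compose2[OF cont 1 2] show ?thesis by simp
  qed
  have "P 0 1"
  proof (rule Bolzano[where P = P])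
    fix a b c assume ab: "P a b" "P b c" "a \<le> b" "b \<le> c"
    show "P a c" unfolding P_def
    proof (intro impI)
      assume ac: "0 \<le> a" "a \<le> c" "c \<le> 1"
      obtain p q where p: "\<And>z. z \<in> K \<Longrightarrow> cmod (integral {a..b} (\<lambda>s. k s z) - poly p z) \<le> e * (b - a)"
        and q: "\<And>z. z \<in> K \<Longrightarrow> cmod (integral {b..c} (\<lambda>s. k s z) - poly q z) \<le> e * (c - b)"
        using ab ac by (auto simp: P_def)
      have "cmod (integral {a..c} (\<lambda>s. k s z) - poly (p + q) z) \<le> e * (c - a)" if z: "z \<in> K" for z
      proof -
        have "integral {a..b} (\<lambda>s. k s z) + integral {b..c} (\<lambda>s. k s z) = integral {a..c} (\<lambda>s. k s z)"
          using ab ac kz[OF _ _ z] by (intro Henstock_Kurzweil_Integration.integral_combine integrable_continuous_real) auto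
        hence "integral {a..c} (\<lambda>s. k s z) - poly (p + q) z
          = (integral {a..b} (\<lambda>s. k s z) - poly p z) + (integral {b..c} (\<lambda>s. k s z) - poly q z)"
          by (simp add: algebra_simps)
        also have "cmod \<dots> \<le> e * (b - a) + e * (c - b)"
          using p[OF z] q[OF z] by (rule norm_triangle_mono)
        finally show ?thesis by (simp add: algebra_simps)
      qed
      thus "\<exists>p. \<forall>z\<in>K. cmod (integral {a..c} (\<lambda>s. k s z) - poly p z) \<le> e * (c - a)" by blast
    qed
  next
    fix x :: real assume x: "0 \<le> x" "x \<le> 1"
    obtain q where q: "\<And>z. z \<in> K \<Longrightarrow> cmod (k x z - poly q z) \<le> e / 2"
      using k[of x] x e unfolding poly_approximable_def by (meson atLeastAtMost_iff half_gt_zero)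
    have "uniformly_continuous_on ({0..1} \<times> K) (\<lambda>(s, z). k s z)"
      using cont K by (intro compact_uniformly_continuous compact_Times) auto
    then obtain d where d: "d > 0" "\<forall>x\<in>{0..1} \<times> K. \<forall>x'\<in>{0..1} \<times> K. dist x' x < d \<longrightarrow>
        dist (case x' of (s, z) \<Rightarrow> k s z) (case x of (s, z) \<Rightarrow> k s z) < e / 2"
      using half_gt_zero[OF e] unfolding uniformly_continuous_on_def by blast
    have "P a b" if ab: "a \<le> x" "x \<le> b" "b - a < d" for a b unfolding P_def
    proof (intro impI)
      assume ab': "0 \<le> a" "a \<le> b" "b \<le> 1"
      have "cmod (integral {a..b} (\<lambda>s. k s z) - poly (smult (of_real (b - a)) q) z) \<le> e * (b - a)"
        if z: "z \<in> K" for z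
      proof -
        have "integral {a..b} (\<lambda>s. k s z) - poly (smult (of_real (b - a)) q) z
          = integral {a..b} (\<lambda>s. k s z - poly q z)"
          using ab' kz[OF _ _ z]
          by (subst Henstock_Kurzweil_Integration.integral_diff)
            (auto intro!: integrable_continuous_real simp: scaleR_conv_of_real)
        also have "cmod \<dots> \<le> e * (b - a)"
        proof (rule integral_bound)
          show "continuous_on {a..b} (\<lambda>s. k s z - poly q z)"
            using ab' kz[OF _ _ z] by (intro continuous_intros) auto
          fix s assume s: "s \<in> {a..b}"
          have "dist (k s z) (k x z) < e / 2"
            using d(2)[rule_format, of "(x, z)" "(s, z)"] s ab ab' x z
            by (simp add: dist_Pair_Pair dist_real_def abs_if split: if_splits)
          thus "cmod (k s z - poly q z) \<le> e"
            using norm_diff_triangle_le[OF _ q[OF z], of "k s z" "e / 2"] by (simp add: dist_norm)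
        qed (use ab' in simp)
        finally show ?thesis .
      qed
      thus "\<exists>p. \<forall>z\<in>K. cmod (integral {a..b} (\<lambda>s. k s z) - poly p z) \<le> e * (b - a)" by blast
    qed
    thus "\<exists>d>0. \<forall>a b. a \<le> x \<and> x \<le> b \<and> b - a < d \<longrightarrow> P a b" using d(1) by blast
  qed simp
  thus "\<exists>p. \<forall>z\<in>K. cmod (integral {0..1} (\<lambda>s. k s z) - poly p z) \<le> e" by (simp add: P_def)
qed

text \<open>Cauchy's formula on the surrounding curve writes \<open>f\<close> as an integral of
  kernels with poles off \<open>K\<close>, each of which is approximable.\<close>

lemma holomorphic_poly_approximable:
  assumes K: "compact K" "convex K" "K \<noteq> {}" and U: "open U" "convex U" "K \<subseteq> U"
    and f: "f holomorphic_on U"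
  shows "poly_approximable K f"
proof -
  obtain h where h: "polynomial_function h" "pathfinish h = pathstart h" "path_image h \<subseteq> U - K"
    "\<And>z. z \<in> K \<Longrightarrow> winding_number h z = 1"
    using convex_surrounding_path[OF K U(1,3)] by metis
  obtain h' where h': "polynomial_function h'" "\<And>x. (h has_vector_derivative h' x) (at x)"
    using has_vector_derivative_polynomial_function[OF h(1)] by blast
  have conth: "continuous_on S h" "continuous_on S h'" for S
    using h(1) h'(1) by (auto intro: continuous_on_polymonial_function)
  have hs: "h s \<in> U" "h s \<notin> K" if "s \<in> {0..1}" for s
    using subsetD[OF h(3), of "h s"] that by (auto simp: path_image_def)
  define k where "k = (\<lambda>s z. f (h s) / (h s - z) * h' s)"
  have rep: "integral {0..1} (\<lambda>s. k s z) = 2 * pi * \<i> * f z" if z: "z \<in> K" for z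
  proof -
    have "((\<lambda>w. f w / (w - z)) has_contour_integral (2 * pi * \<i> * winding_number h z * f z)) h"
      using U z h(2,3) valid_path_polynomial_function[OF h(1)] f
      by (intro Cauchy_integral_formula_convex_simple[of U]) (auto simp: interior_open)
    hence "((\<lambda>s. f (h s) / (h s - z) * vector_derivative h (at s within {0..1})) has_integral
        (2 * pi * \<i> * f z)) {0..1}"
      using h(4)[OF z] by (simp add: has_contour_integral_def)
    hence "((\<lambda>s. k s z) has_integral (2 * pi * \<i> * f z)) {0..1}"
      by (rule has_integral_eq[rotated])
        (simp add: k_def vector_derivative_at_within_ivl[OF h'(2)])
    thus ?thesis by (rule integral_unique)
  qed
  have "poly_approximable K (\<lambda>z. integral {0..1} (\<lambda>s. k s z))"
  proof (rule parametric_integral_poly_approximable[OF K(1)])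
    have "continuous_on {0..1} (\<lambda>s. f (h s))"
      by (rule continuous_on_compose2[OF holomorphic_on_imp_continuous_on[OF f] conth(1)]) (use hs in auto)
    hence "continuous_on ({0..1} \<times> K) (\<lambda>x. f (h (fst x)))"
      by (rule continuous_on_compose2) (auto intro!: continuous_intros)
    moreover have "continuous_on ({0..1} \<times> K) (\<lambda>x. h (fst x))" "continuous_on ({0..1} \<times> K) (\<lambda>x. h' (fst x))"
      by (rule continuous_on_compose2[OF conth(1)[of UNIV]] continuous_on_compose2[OF conth(2)[of UNIV]];
          auto intro!: continuous_intros)+
    ultimately show "continuous_on ({0..1} \<times> K) (\<lambda>(s, z). k s z)"
      unfolding k_def case_prod_beta using hs by (intro continuous_intros) auto
    show "poly_approximable K (k s)" if "s \<in> {0..1}" for s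
      using poly_approximable_cmult[OF cauchy_kernel_poly_approximable[OF K hs(2)[OF that]], of "f (h s) * h' s"]
      by (simp add: k_def)
  qed
  hence "poly_approximable K (\<lambda>z. 1 / (2 * pi * \<i>) * integral {0..1} (\<lambda>s. k s z))"
    by (rule poly_approximable_cmult)
  thus ?thesis unfolding poly_approximable_def by (simp add: rep)
qed

section \<open>From segments and holomorphic functions to the whole algebra\<close>

lemma polynomial_function_imp_poly:
  fixes g :: "real \<Rightarrow> complex"
  assumes "polynomial_function g"
  obtains p where "\<And>x. g x = poly p (of_real x)"
proof -
  have "real_polynomial_function (Re \<circ> g)" "real_polynomial_function (Im \<circ> g)"
    using assms bounded_linear_Re bounded_linear_Im unfolding polynomial_function_def by auto
  then obtain a n b m where a: "Re \<circ> g = (\<lambda>x. \<Sum>i\<le>n. a i * x ^ i)" and b: "Im \<circ> g = (\<lambda>x. \<Sum>i\<le>m. b i * x ^ i)"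
    unfolding real_polynomial_function_iff_sum by metis
  define p where "p = (\<Sum>i\<le>n. monom (complex_of_real (a i)) i) + (\<Sum>i\<le>m. monom (\<i> * of_real (b i)) i)"
  have "g x = poly p (of_real x)" for x
  proof -
    have "g x = of_real ((Re \<circ> g) x) + \<i> * of_real ((Im \<circ> g) x)" by (simp add: complex_eq[symmetric])
    also have "\<dots> = poly p (of_real x)"
      unfolding a b by (simp add: p_def poly_sum poly_monom sum_distrib_left mult.assoc)
    finally show ?thesis .
  qed
  thus ?thesis by (rule that)
qed

text \<open>A convex compact set without interior lies on a line; the real coordinate along it
  reduces the claim to Weierstrass approximation, and that coordinate is affine in z on
  \<open>K\<close>.\<close>

lemma segment_poly_approximable:
  assumes K: "compact K" "K \<subseteq> {x. inner d x = \<beta>}" "d \<noteq> 0" "K \<noteq> {}" and f: "continuous_on K f"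
  shows "poly_approximable K f"
  unfolding poly_approximable_def
proof (intro allI impI)
  fix e :: real assume e: "e > 0"
  obtain z0 where z0: "z0 \<in> K" using K(4) by blast
  \<comment> \<open>The direction of the line: the normal \<open>d\<close> turned by a right
    angle.\<close>
  define w where "w = \<i> * d"
  have w: "w \<noteq> 0" using K(3) by (simp add: w_def)
  define r where "r = (\<lambda>z. Re ((z - z0) / w))"
  have rz: "of_real (r z) = (z - z0) / w" if "z \<in> K" for z
  proof -
    have "inner d (z - z0) = 0" using K(2) that z0 by (auto simp: inner_diff_right)
    hence "Im ((z - z0) / w) = 0" using K(3)
      by (simp add: w_def Im_divide inner_complex_def) (simp add: algebra_simps)
    thus ?thesis by (simp add: r_def complex_eq_iff)
  qed
  hence zr: "z0 + of_real (r z) * w = z" if "z \<in> K" for z using that w by simp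
  have "compact (r ` K)" unfolding r_def using w by (intro compact_continuous_image continuous_intros K) auto
  moreover have "continuous_on (r ` K) (\<lambda>s. f (z0 + of_real s * w))"
    by (rule continuous_on_compose2[OF f]) (auto intro!: continuous_intros simp: zr)
  ultimately obtain g where g: "polynomial_function g"
    "\<And>s. s \<in> r ` K \<Longrightarrow> cmod (f (z0 + of_real s * w) - g s) < e"
    using Stone_Weierstrass_polynomial_function[OF _ _ e] by metis
  obtain p where p: "\<And>x. g x = poly p (of_real x)"
    using polynomial_function_imp_poly[OF g(1)] by blast
  have "cmod (f z - poly (pcompose p [:- z0 / w, 1 / w:]) z) \<le> e" if "z \<in> K" for z
    using g(2)[of "r z"] that zr[OF that] rz[OF that]
    by (simp add: p poly_pcompose diff_divide_distrib)
  thus "\<exists>p. \<forall>z\<in>K. cmod (f z - poly p z) \<le> e" by blast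
qed

text \<open>Shrinking towards an interior point moves the convex set \<open>K\<close> into its own
  interior, so the dilated function is holomorphic near \<open>K\<close>; uniform continuity keeps
  it close to \<open>f\<close>.\<close>

theorem analytic_algebra_poly_approximable:
  assumes K: "compact K" "convex K" "K \<noteq> {}" and f: "f \<in> analytic_algebra K"
  shows "poly_approximable K f"
proof (cases "interior K = {}")
  case True
  obtain d \<beta> where "d \<noteq> 0" "K \<subseteq> {x. inner d x = \<beta>}"
    using empty_interior_subset_hyperplane[OF K(2) True] .
  thus ?thesis using K f by (intro segment_poly_approximable) (auto simp: analytic_algebra_def)
next
  case False
  then obtain z0 where z0: "z0 \<in> interior K" by blast
  have contf: "continuous_on K f" and holf: "f holomorphic_on interior K"
    using f by (auto simp: analytic_algebra_def analytic_imp_holomorphic)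
  show ?thesis
  proof (rule poly_approximable_uniform)
    fix e :: real assume e: "e > 0"
    have "uniformly_continuous_on K f" using contf K(1) by (rule compact_uniformly_continuous)
    then obtain d where d: "d > 0" "\<And>x y. x \<in> K \<Longrightarrow> y \<in> K \<Longrightarrow> dist y x < d \<Longrightarrow> dist (f y) (f x) < e"
      using e unfolding uniformly_continuous_on_def by blast
    obtain D where D: "D > 0" "\<And>z. z \<in> K \<Longrightarrow> dist z0 z \<le> D"
      using compact_imp_bounded[OF K(1)] bounded_any_center[of K z0]
      by (metis less_le_trans linear zero_less_one order_trans)
    define s where "s = min (1/2) (d / (2 * D))"
    have s: "0 < s" "s < 1" "s * D < d" using d D by (auto simp: s_def min_def field_simps)
    define \<phi> where "\<phi> = (\<lambda>z. z - of_real s * (z - z0))"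
    define U where "U = \<phi> -` interior K"
    have \<phi>: "\<phi> z \<in> interior K" if "z \<in> K" for z
      using mem_interior_convex_shrink[OF K(2) z0 that, of s] s
      by (simp add: \<phi>_def scaleR_conv_of_real)
    have cont\<phi>: "continuous_on S \<phi>" for S unfolding \<phi>_def by (intro continuous_intros)
    have "poly_approximable K (f \<circ> \<phi>)"
    proof (rule holomorphic_poly_approximable[OF K])
      show "open U" unfolding U_def by (intro open_vimage cont\<phi>) auto
      show "K \<subseteq> U" using \<phi> by (auto simp: U_def)
      show "convex U"
      proof (rule convexI)
        fix x y :: complex and u v :: real assume *: "x \<in> U" "y \<in> U" "0 \<le> u" "0 \<le> v" "u + v = 1"
        have v: "v = 1 - u" using * by simp
        have "\<phi> (u *\<^sub>R x + v *\<^sub>R y) = u *\<^sub>R \<phi> x + v *\<^sub>R \<phi> y"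
          unfolding v \<phi>_def by (simp add: scaleR_conv_of_real algebra_simps)
        thus "u *\<^sub>R x + v *\<^sub>R y \<in> U"
          using * convexD[OF convex_interior[OF K(2)], of "\<phi> x" "\<phi> y" u v] by (simp add: U_def)
      qed
      show "f \<circ> \<phi> holomorphic_on U"
        by (rule holomorphic_on_compose_gen[OF _ holf])
          (auto simp: U_def \<phi>_def intro!: holomorphic_intros)
    qed
    moreover have "cmod (f z - (f \<circ> \<phi>) z) \<le> e" if z: "z \<in> K" for z
    proof -
      have "dist z (\<phi> z) = s * dist z0 z" using s
        by (simp add: \<phi>_def dist_norm norm_mult norm_minus_commute)
      also have "\<dots> < d" using mult_left_mono[OF D(2)[OF z], of s] s by linarith
      finally have "dist (f z) (f (\<phi> z)) < e"
        using \<phi>[OF z] interior_subset[of K] z by (intro d(2)) auto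
      thus ?thesis by (simp add: dist_norm)
    qed
    ultimately show "\<exists>g. poly_approximable K g \<and> (\<forall>z\<in>K. cmod (f z - g z) \<le> e)" by blast
  qed
qed

section \<open>The numerical range\<close>

lemma clinear_matrix: "clinear ((*v) (A :: complex^'n^'n))"
  by (rule matrix_vector_mul_linear_gen)

lemma mem_numerical_range:
  "z \<in> numerical_range A \<longleftrightarrow> (\<exists>x. norm x = 1 \<and> z = cinner (A *v x) x)"
  by (auto simp: numerical_range_def cinner_self_eq_1)

lemma compact_numerical_range: "compact (numerical_range A)"
proof -
  have "numerical_range A = (\<lambda>x. cinner (A *v x) x) ` sphere 0 1"
    by (auto simp: mem_numerical_range)
  moreover have "continuous_on (sphere 0 1) (\<lambda>x. cinner (A *v x) x)"
    unfolding cinner_def matrix_vector_mult_def by (intro continuous_intros)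
  ultimately show ?thesis by (simp add: compact_continuous_image)
qed

lemma numerical_range_nonempty: "numerical_range A \<noteq> {}"
proof -
  have "norm (axis undefined 1 :: complex^'a) = 1"
    using cinner_self_eq_1[of "axis undefined 1 :: complex^'a"]
    by (simp add: cinner_def axis_def if_distrib[of "\<lambda>c. c * _"] cong: if_cong)
  thus ?thesis using mem_numerical_range by blast
qed

lemma eigenvalue_in_numerical_range:
  assumes T: "clinear T" and W: "\<And>x. norm x = 1 \<Longrightarrow> cinner (T x) x \<in> W"
    and x: "T x = a *s x" "x \<noteq> 0"
  shows "a \<in> W"
proof -
  define y where "y = of_real (1 / norm x) *s x"
  have y: "norm y = 1" using x(2) by (simp add: y_def norm_vector_scale norm_divide)
  have "T y = a *s y" by (simp add: y_def vec.linear_scale[OF T] x(1) mult.commute)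
  hence "cinner (T y) y = a" using y by (simp add: cinner_scale_left cinner_self)
  thus ?thesis using W[OF y] by simp
qed

text \<open>An affine change of the form sends the two given values to 0 and 1. If the cross terms
  are real, the form is real along the segment from x' to y and, once normalised, takes every value
  between 0 and 1.\<close>

lemma Toeplitz_Hausdorff: "convex (numerical_range A)"
proof (rule convexI)
  fix a b :: complex and p s :: real
  assume ab: "a \<in> numerical_range A" "b \<in> numerical_range A" and ps: "0 \<le> p" "0 \<le> s" "p + s = 1"
  obtain x y where x: "norm x = 1" "a = cinner (A *v x) x" and y: "norm y = 1" "b = cinner (A *v y) y"
    using ab by (auto simp: mem_numerical_range)
  show "p *\<^sub>R a + s *\<^sub>R b \<in> numerical_range A"
  proof (cases "a = b")
    case True
    thus ?thesis using ab ps by (simp flip: scaleR_add_left)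
  next
    case False
    define C where "C = (\<lambda>x y. (cinner (A *v x) y - a * cinner x y) / (b - a))"
    have lin: "C (x + y) z = C x z + C y z" "C z (x + y) = C z x + C z y"
      "C (c *s x) y = c * C x y" "C x (c *s y) = cnj c * C x y" for x y z c
      unfolding C_def matrix_vector_right_distrib vector_scalar_commute cinner_add_left cinner_add_right
        cinner_scale_left cinner_scale_right
      by (simp_all add: add_divide_distrib diff_divide_distrib algebra_simps)
    have Cx: "C x x = 0" and Cy: "C y y = 1"
      using x y False by (simp_all add: C_def cinner_self)
    define \<delta> where "\<delta> = C x y - cnj (C y x)"
    \<comment> \<open>The phase that makes \<kappa> \<delta> real; Im (\<kappa> \<delta>) is the
      imaginary part of the cross terms after \<open>x\<close> is replaced by \<kappa> x.\<close>
    define \<kappa> where "\<kappa> = (if \<delta> = 0 then 1 else cnj \<delta> / of_real (cmod \<delta>))"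
    have \<kappa>: "cmod \<kappa> = 1" by (simp add: \<kappa>_def norm_divide)
    have "\<kappa> * \<delta> = of_real (cmod \<delta>)"
    proof (cases "\<delta> = 0")
      case False
      have "cnj \<delta> * \<delta> = of_real (cmod \<delta>) * of_real (cmod \<delta>)"
        by (metis complex_norm_square mult.commute of_real_power power2_eq_square)
      thus ?thesis using False by (simp add: \<kappa>_def)
    qed simp
    hence "Im (\<kappa> * \<delta>) = 0" by simp
    hence real: "Im (\<kappa> * C x y + cnj \<kappa> * C y x) = 0"
      by (simp add: \<delta>_def algebra_simps)
    define x' where "x' = \<kappa> *s x"
    have x': "norm x' = 1" "C x' x' = 0" "C x' y + C y x' = of_real (Re (C x' y + C y x'))"
      using \<kappa> x(1) Cx real by (auto simp: x'_def norm_vector_scale lin complex_eq_iff)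
    define z where "z = (\<lambda>r::real. of_real (1 - r) *s x' + of_real r *s y)"
    define m where "m = Re (C x' y + C y x')"
    have Cz: "C (z r) (z r) = of_real (r * (1 - r) * m + r\<^sup>2)" for r
    proof -
      have "C (z r) (z r) = of_real (r * (1 - r)) * (C x' y + C y x') + of_real (r\<^sup>2)"
        unfolding z_def lin x'(2) Cy complex_cnj_complex_of_real
        by (simp add: algebra_simps power2_eq_square)
      also have "C x' y + C y x' = of_real m" unfolding m_def by (rule x'(3))
      finally show ?thesis by simp
    qed
    have z_nz: "z r \<noteq> 0" for r
    proof
      assume z0: "z r = 0"
      hence "of_real r *s y = - (of_real (1 - r) *s x')" unfolding z_def add_eq_0_iff .
      also have "\<dots> = of_real (r - 1) *s x'" by (simp flip: vec.scale_minus_left)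
      finally have eq: "of_real r *s y = of_real (r - 1) *s x'" .
      hence "C (of_real r *s y) (of_real r *s y) = C (of_real (r - 1) *s x') (of_real (r - 1) *s x')" by simp
      hence "r = 0" unfolding lin Cy x'(2) by simp
      with eq x'(1) show False by simp
    qed
    define h where "h = (\<lambda>r. (r * (1 - r) * m + r\<^sup>2) / (norm (z r))\<^sup>2)"
    have z01: "z 0 = x'" "z 1 = y" by (simp_all add: z_def)
    have "continuous_on {0..1} z"
    proof -
      have "z = (\<lambda>r. (1 - r) *\<^sub>R x' + r *\<^sub>R y)" by (simp add: z_def scaleR_eq_scale)
      thus ?thesis by (simp add: continuous_intros)
    qed
    hence "continuous_on {0..1} h" unfolding h_def using z_nz by (intro continuous_intros) auto
    then obtain r where "h r = s"
      using IVT'[of h 0 s 1] ps y(1) z01 by (auto simp: h_def)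
    define v where "v = of_real (1 / norm (z r)) *s z r"
    have v: "norm v = 1" using z_nz by (simp add: v_def norm_vector_scale norm_divide)
    have "C v v = of_real s" unfolding \<open>h r = s\<close>[symmetric] h_def v_def
      by (simp add: lin Cz power2_eq_square)
    hence "cinner (A *v v) v = a + of_real s * (b - a)"
      using v False by (simp add: C_def cinner_self field_simps)
    moreover have p: "p = 1 - s" using ps by simp
    have "a + of_real s * (b - a) = p *\<^sub>R a + s *\<^sub>R b"
      unfolding p by (simp add: scaleR_conv_of_real algebra_simps)
    ultimately show ?thesis using v by (metis mem_numerical_range)
  qed
qed

text \<open>The synthetic quotient is (p(z) - p(a)) / (z - a). Away from a the denominator is
  bounded below; near a the maximum principle takes over. This is why a must be an interior
  point.\<close>

lemma uniform_limit_synthetic_div: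
  fixes p :: "nat \<Rightarrow> complex poly"
  assumes a: "a \<in> interior W" and p: "uniform_limit W (\<lambda>k. poly (p k)) (\<lambda>_. 0) sequentially"
  shows "uniform_limit W (\<lambda>k. poly (synthetic_div (p k) a)) (\<lambda>_. 0) sequentially"
proof (rule uniform_limitI)
  fix e :: real assume e: "e > 0"
  obtain d where d: "d > 0" "cball a d \<subseteq> W"
    using a mem_interior_cball by blast
  have "\<forall>\<^sub>F k in sequentially. \<forall>z\<in>W. dist (poly (p k) z) 0 < e * d / 3"
    using p e d by (intro uniform_limitD) auto
  thus "\<forall>\<^sub>F k in sequentially. \<forall>z\<in>W. dist (poly (synthetic_div (p k) a) z) 0 < e"
  proof eventually_elim
    case (elim k)
    define q where "q = synthetic_div (p k) a"
    have aW: "a \<in> W" using a interior_subset by blast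
    have pq: "poly (p k) z - poly (p k) a = (z - a) * poly q z" for z
      using arg_cong[OF synthetic_div_correct'[of a "p k"], of "\<lambda>r. poly r z"]
      by (simp add: q_def algebra_simps)
    have away: "cmod (poly q z) \<le> 2 * e / 3" if z: "z \<in> W" "d \<le> cmod (z - a)" for z
    proof -
      have "d * cmod (poly q z) \<le> cmod (z - a) * cmod (poly q z)" using z by (intro mult_right_mono) auto
      also have "\<dots> = cmod (poly (p k) z - poly (p k) a)" by (simp add: pq norm_mult)
      also have "\<dots> \<le> cmod (poly (p k) z) + cmod (poly (p k) a)" by (rule norm_triangle_ineq4)
      also have "\<dots> \<le> e * d / 3 + e * d / 3" using elim z aW by (intro add_mono) (auto intro: less_imp_le)
      finally show ?thesis using d by (simp add: field_simps)
    qed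
    have "cmod (poly q z) \<le> 2 * e / 3" if z: "z \<in> W" for z
    proof (cases "d \<le> cmod (z - a)")
      case False
      show ?thesis
      proof (rule maximum_modulus_frontier[of "poly q" "cball a d"])
        show "z \<in> cball a d" using False by (simp add: dist_norm norm_minus_commute)
        show "cmod (poly q w) \<le> 2 * e / 3" if "w \<in> frontier (cball a d)" for w
          using that d by (intro away) (auto simp: dist_norm norm_minus_commute)
      qed (auto intro!: holomorphic_intros continuous_intros)
    qed (use away z in auto)
    thus ?case using e by (fastforce simp: q_def)
  qed
qed

text \<open>Roots of an annihilating polynomial in the interior of \<open>W\<close> can be divided out by the maximum
  principle; the remaining eigenvalues are semisimple.\<close>

theorem poly_op_tendsto_0:
  fixes T :: "complex^'n \<Rightarrow> complex^'n"
  assumes T: "clinear T" and W: "\<And>x. norm x = 1 \<Longrightarrow> cinner (T x) x \<in> W"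
    and p: "uniform_limit W (\<lambda>k. poly (p k)) (\<lambda>_. 0) sequentially"
  shows "(\<lambda>k. poly_op (p k) T x) \<longlonglongrightarrow> 0"
proof -
  obtain \<mu> where "\<mu> \<noteq> 0" "poly_op \<mu> T x = 0" using exists_annihilating_poly by blast
  thus ?thesis using p
  proof (induction "degree \<mu>" arbitrary: \<mu> x p rule: less_induct)
    case less
    have scale: "(\<lambda>k. poly (p k) a *s y) \<longlonglongrightarrow> 0" if "a \<in> W" for a and y :: "complex^'n"
    proof -
      have "(\<lambda>k. poly (p k) a) \<longlonglongrightarrow> 0" by (rule tendsto_uniform_limitI[OF less.prems(3) that])
      hence "(\<lambda>k. cmod (poly (p k) a) * norm y) \<longlonglongrightarrow> 0" by (intro tendsto_mult_left_zero tendsto_norm_zero)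
      hence "(\<lambda>k. norm (poly (p k) a *s y)) \<longlonglongrightarrow> 0" by (simp add: norm_vector_scale)
      thus ?thesis by (rule tendsto_norm_zero_cancel)
    qed
    show ?case
    proof (cases "degree \<mu> = 0")
      case True
      then obtain c where "\<mu> = [:c:]" by (rule degree_eq_zeroE)
      hence "x = 0" using less.prems by (simp add: poly_op_pCons)
      thus ?thesis by (simp add: poly_op_zero_vec[OF T])
    next
      case False
      then obtain a q where q: "\<mu> = [:-a, 1:] * q" "degree q < degree \<mu>" "q \<noteq> 0"
        by (rule poly_root_factor)
      note IH = less.hyps[OF q(2,3)]
      show ?thesis
      proof (cases "a \<in> interior W")
        case True
        hence aW: "a \<in> W" using interior_subset by blast
        \<comment> \<open>The vector T x - a x is annihilated by the shorter polynomial q, and p(T)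
          x differs from the quotient applied to it only by p(a) x.\<close>
        have "poly_op q T (T x - a *s x) = poly_op \<mu> T x"
          unfolding q(1) mult.commute[of _ q] poly_op_mult[OF T] poly_op_linear_factor ..
        hence "(\<lambda>k. poly_op (synthetic_div (p k) a) T (T x - a *s x)) \<longlonglongrightarrow> 0"
          using less.prems(2) by (intro IH uniform_limit_synthetic_div True less.prems) simp
        from tendsto_add[OF this scale[OF aW]]
        have "(\<lambda>k. poly_op (synthetic_div (p k) a) T (T x - a *s x) + poly (p k) a *s x) \<longlonglongrightarrow> 0" by simp
        also have "(\<lambda>k. poly_op (synthetic_div (p k) a) T (T x - a *s x) + poly (p k) a *s x)
          = (\<lambda>k. poly_op (p k) T x)"
        proof
          fix k
          have "poly_op (p k) T x
              = poly_op (synthetic_div (p k) a * [:-a, 1:] + [:poly (p k) a:]) T x"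
            using synthetic_div_correct'[of a "p k"] by (simp only: mult.commute)
          thus "poly_op (synthetic_div (p k) a) T (T x - a *s x) + poly (p k) a *s x = poly_op (p k) T x"
            unfolding poly_op_add poly_op_mult[OF T] poly_op_linear_factor by (simp add: poly_op_pCons)
        qed
        finally show ?thesis .
      next
        case nint: False
        define y where "y = poly_op q T x"
        have Ty: "T y = a *s y"
          using less.prems(2) unfolding q(1) poly_op_mult[OF T] poly_op_linear_factor by (simp add: y_def)
        show ?thesis
        proof (cases "poly q a = 0")
          case True
          then obtain \<sigma> where \<sigma>: "q = [:-a, 1:] * \<sigma>" by (auto simp: poly_eq_0_iff_dvd dvd_def)
          \<comment> \<open>If a is a double root, \<sigma>(T) x and y would form a Jordan chain
            unless y = 0; outside the interior this leaves y = 0, so q already annihilates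
            x.\<close>
          have "T (poly_op \<sigma> T x) = a *s poly_op \<sigma> T x + y"
            unfolding y_def \<sigma> poly_op_mult[OF T] poly_op_linear_factor by simp
          hence "y = 0" using defective_eigenvalue_in_interior[OF T W _ Ty] nint by blast
          thus ?thesis using IH less.prems(3) by (simp add: y_def)
        next
          case qa: False
          \<comment> \<open>For a simple root, x splits into a multiple of the vector y, which
            satisfies T y = a y, and a part annihilated by q, because q(T) y = q(a) y.\<close>
          define x' where "x' = x - (1 / poly q a) *s y"
          have "poly_op q T x' = 0"
            using qa by (simp add: x'_def poly_op_diff_vec[OF T] poly_op_scale_vec[OF T]
                poly_op_eigenvector[OF T Ty] flip: y_def)
          hence "(\<lambda>k. poly_op (p k) T x') \<longlonglongrightarrow> 0" by (rule IH) (rule less.prems)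
          moreover have "(\<lambda>k. poly_op (p k) T ((1 / poly q a) *s y)) \<longlonglongrightarrow> 0"
          proof (cases "y = 0")
            case True
            thus ?thesis by (simp add: poly_op_zero_vec[OF T])
          next
            case False
            hence "a \<in> W" using eigenvalue_in_numerical_range[OF T W Ty] by blast
            from scale[OF this, of "(1 / poly q a) *s y"] show ?thesis
              by (simp add: poly_op_scale_vec[OF T] poly_op_eigenvector[OF T Ty] mult.commute)
          qed
          ultimately have "(\<lambda>k. poly_op (p k) T x' + poly_op (p k) T ((1 / poly q a) *s y)) \<longlonglongrightarrow> 0 + 0"
            by (rule tendsto_add)
          thus ?thesis by (simp add: x'_def flip: poly_op_add_vec[OF T])
        qed
      qed
    qed
  qed
qed

section \<open>The functional calculus\<close>

text \<open>Real orthogonal decomposition supplies the candidate; testing against both v and i v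
  makes real orthogonality complex.\<close>

lemma orth_proj:
  fixes V :: "(complex^'n) set"
  assumes V: "vec.subspace V"
  shows orth_proj_in: "orth_proj V x \<in> V"
    and orth_proj_orthogonal: "v \<in> V \<Longrightarrow> cinner (x - orth_proj V x) v = 0"
    and orth_proj_eqI: "y \<in> V \<Longrightarrow> (\<And>v. v \<in> V \<Longrightarrow> cinner (x - y) v = 0) \<Longrightarrow> orth_proj V x = y"
proof -
  have uniq: "y = y'" if "y \<in> V" "\<forall>v\<in>V. cinner (x - y) v = 0" "y' \<in> V" "\<forall>v\<in>V. cinner (x - y') v = 0" for y y'
  proof -
    have d: "y - y' \<in> V" using that V by (intro vec.subspace_diff)
    have "cinner (y - y') (y - y') = cinner (x - y') (y - y') - cinner (x - y) (y - y')"
      by (simp flip: cinner_diff_left)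
    also have "\<dots> = 0" using that d by simp
    finally show ?thesis by (simp add: cinner_self)
  qed
  have "subspace V"
    using V by (auto simp: subspace_def scaleR_eq_scale vec.subspace_0 vec.subspace_add vec.subspace_scale)
  hence sp: "span V = V" by (simp add: span_eq_iff)
  obtain y0 z0 where yz: "y0 \<in> V" "\<And>w. w \<in> V \<Longrightarrow> orthogonal z0 w" "x = y0 + z0"
    using orthogonal_subspace_decomp_exists[of V x] unfolding sp by metis
  have "cinner (x - y0) v = 0" if "v \<in> V" for v
  proof -
    have "\<i> *s v \<in> V" using that V by (rule vec.subspace_scale[rotated])
    hence "Re (cinner z0 v) = 0" "Re (cinner z0 (\<i> *s v)) = 0"
      using yz(2) that by (auto simp: Re_cinner orthogonal_def)
    thus ?thesis using yz(3) by (simp add: cinner_scale_right complex_eq_iff)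
  qed
  hence ex1: "\<exists>!y. y \<in> V \<and> (\<forall>v\<in>V. cinner (x - y) v = 0)" using yz(1) uniq by blast
  from theI'[OF this] show "orth_proj V x \<in> V" "v \<in> V \<Longrightarrow> cinner (x - orth_proj V x) v = 0"
    unfolding orth_proj_def by auto
  show "orth_proj V x = y" if "y \<in> V" "\<And>v. v \<in> V \<Longrightarrow> cinner (x - y) v = 0"
    unfolding orth_proj_def using ex1 that by (intro the1_equality) auto
qed

lemma clinear_compression:
  assumes V: "vec.subspace V"
  shows "clinear (compression A V)"
proof -
  have 1: "compression A V (x + y) = compression A V x + compression A V y" for x y
    unfolding compression_def
  proof (rule orth_proj_eqI[OF V])
    show "orth_proj V (A *v x) + orth_proj V (A *v y) \<in> V"
      using V by (intro vec.subspace_add orth_proj_in)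
    fix v assume "v \<in> V"
    hence "cinner ((A *v x - orth_proj V (A *v x)) + (A *v y - orth_proj V (A *v y))) v = 0"
      by (simp add: cinner_add_left orth_proj_orthogonal[OF V])
    thus "cinner (A *v (x + y) - (orth_proj V (A *v x) + orth_proj V (A *v y))) v = 0"
      by (simp add: matrix_vector_right_distrib algebra_simps)
  qed
  have 2: "compression A V (c *s x) = c *s compression A V x" for c x
    unfolding compression_def
  proof (rule orth_proj_eqI[OF V])
    show "c *s orth_proj V (A *v x) \<in> V"
      using V by (intro vec.subspace_scale orth_proj_in)
    fix v assume "v \<in> V"
    hence "cinner (c *s (A *v x - orth_proj V (A *v x))) v = 0"
      unfolding cinner_scale_left by (simp only: orth_proj_orthogonal[OF V] mult_zero_right)
    thus "cinner (A *v (c *s x) - c *s orth_proj V (A *v x)) v = 0"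
      unfolding vector_scalar_commute vec.scale_right_diff_distrib .
  qed
  show ?thesis using 1 2 by (simp add: Vector_Spaces.linear_iff vec.vector_space_axioms)
qed

lemma compression_numerical_range:
  assumes V: "vec.subspace V" and x: "x \<in> V" "norm x = 1"
  shows "cinner (compression A V x) x \<in> numerical_range A"
proof -
  have "cinner (A *v x) x = cinner (compression A V x) x"
    using orth_proj_orthogonal[OF V x(1), of "A *v x"] by (simp add: compression_def cinner_diff_left)
  thus ?thesis using x(2) by (metis mem_numerical_range)
qed

text \<open>Two sequences approximating the same function differ by a null sequence, so
  \<open>null\<close> is exactly what uniqueness in the definite description requires.\<close>

lemma fun_op_eqI:
  assumes p: "uniform_limit K (\<lambda>k. poly (p k)) f sequentially" "(\<lambda>k. poly_op (p k) T x) \<longlonglongrightarrow> y"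
    and null: "\<And>q. uniform_limit K (\<lambda>k. poly (q k)) (\<lambda>_. 0) sequentially \<Longrightarrow> (\<lambda>k. poly_op (q k) T x) \<longlonglongrightarrow> 0"
  shows "fun_op K f T x = y"
  unfolding fun_op_def
proof (rule the_equality)
  show "\<exists>p. uniform_limit K (\<lambda>k. poly (p k)) f sequentially \<and> (\<lambda>k. poly_op (p k) T x) \<longlonglongrightarrow> y"
    using p by blast
next
  fix y' assume "\<exists>p. uniform_limit K (\<lambda>k. poly (p k)) f sequentially \<and> (\<lambda>k. poly_op (p k) T x) \<longlonglongrightarrow> y'"
  then obtain p' where p': "uniform_limit K (\<lambda>k. poly (p' k)) f sequentially" "(\<lambda>k. poly_op (p' k) T x) \<longlonglongrightarrow> y'"
    by blast
  have "uniform_limit K (\<lambda>k. poly (p' k - p k)) (\<lambda>_. 0) sequentially"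
  proof -
    have "(\<lambda>k. poly (p' k - p k)) = (\<lambda>k z. poly (p' k) z - poly (p k) z)" by (simp add: fun_eq_iff)
    thus ?thesis using uniform_limit_minus[OF p'(1) p(1)] by simp
  qed
  from null[OF this] have "(\<lambda>k. poly_op (p' k) T x - poly_op (p k) T x) \<longlonglongrightarrow> 0"
    by (simp add: poly_op_diff)
  hence "y' - y = 0" by (rule LIMSEQ_unique[OF tendsto_diff[OF p'(2) p(2)]])
  thus "y' = y" by simp
qed

text \<open>The polynomial bound is used three times: for uniqueness of the limit, for its existence
  through the Cauchy property, and for the final estimate.\<close>

lemma fun_op_norm_le:
  fixes T :: "complex^'n \<Rightarrow> complex^'n"
  assumes T: "clinear T" and V: "vec.subspace V" "T ` V \<subseteq> V" "vec.dim V \<le> 2"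
    and W: "\<And>x. x \<in> V \<Longrightarrow> norm x = 1 \<Longrightarrow> cinner (T x) x \<in> K"
    and K: "compact K" "convex K" "K \<noteq> {}" and f: "f \<in> analytic_algebra K"
    and M: "\<And>z. z \<in> K \<Longrightarrow> cmod (f z) \<le> M" and x: "x \<in> V"
  shows "norm (fun_op K f T x) \<le> 2 * M * norm x"
proof -
  have bound: "norm (poly_op q T x) \<le> 2 * e * norm x" if "\<And>z. z \<in> K \<Longrightarrow> cmod (poly q z) \<le> e" for q e
    using crouzeix_dim_le_2[OF T V W that x] .
  \<comment> \<open>Adding 1 keeps the divisor positive when x = 0.\<close>
  define B where "B = norm x + 1"
  have B: "B > 0" "norm x \<le> B" by (simp_all add: B_def add_nonneg_pos)
  have null: "(\<lambda>k. poly_op (q k) T x) \<longlonglongrightarrow> 0"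
    if q: "uniform_limit K (\<lambda>k. poly (q k)) (\<lambda>_. 0) sequentially" for q
  proof (rule LIMSEQ_I)
    fix r :: real assume r: "r > 0"
    define e where "e = r / (4 * B)"
    have e: "e > 0" using r B by (simp add: e_def)
    obtain N where N: "\<And>k z. k \<ge> N \<Longrightarrow> z \<in> K \<Longrightarrow> cmod (poly (q k) z) < e"
      using uniform_limitD[OF q e] unfolding eventually_sequentially by auto
    have "norm (poly_op (q k) T x - 0) < r" if k: "k \<ge> N" for k
    proof -
      have "norm (poly_op (q k) T x) \<le> 2 * e * norm x" by (rule bound) (use N[OF k] in \<open>auto intro: less_imp_le\<close>)
      also have "\<dots> \<le> 2 * e * B" using e B by (intro mult_left_mono) auto
      also have "\<dots> = r / 2" using B by (simp add: e_def)
      finally show ?thesis using r by simp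
    qed
    thus "\<exists>no. \<forall>n\<ge>no. norm (poly_op (q n) T x - 0) < r" by blast
  qed
  obtain p where p: "uniform_limit K (\<lambda>k. poly (p k)) f sequentially"
    using poly_approximable_uniform_limit[OF analytic_algebra_poly_approximable[OF K f]] .
  have "Cauchy (\<lambda>k. poly_op (p k) T x)"
  proof (rule CauchyI)
    fix r :: real assume r: "r > 0"
    define e where "e = r / (4 * B)"
    have e: "e > 0" using r B by (simp add: e_def)
    have "uniformly_Cauchy_on K (\<lambda>k. poly (p k))" using p by (metis uniformly_convergent_on_def uniformly_convergent_Cauchy)
    then obtain N where N: "\<And>m n z. m \<ge> N \<Longrightarrow> n \<ge> N \<Longrightarrow> z \<in> K \<Longrightarrow> dist (poly (p m) z) (poly (p n) z) < e"
      using e unfolding uniformly_Cauchy_on_def by meson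
    have "norm (poly_op (p m) T x - poly_op (p n) T x) < r" if mn: "m \<ge> N" "n \<ge> N" for m n
    proof -
      have "norm (poly_op (p m - p n) T x) \<le> 2 * e * norm x"
        by (rule bound) (use N[OF mn] in \<open>auto simp: dist_norm intro: less_imp_le\<close>)
      also have "\<dots> \<le> 2 * e * B" using e B by (intro mult_left_mono) auto
      also have "\<dots> = r / 2" using B by (simp add: e_def)
      finally show ?thesis using r by (simp add: poly_op_diff)
    qed
    thus "\<exists>M. \<forall>m\<ge>M. \<forall>n\<ge>M. norm (poly_op (p m) T x - poly_op (p n) T x) < r" by blast
  qed
  then obtain y where y: "(\<lambda>k. poly_op (p k) T x) \<longlonglongrightarrow> y"
    using Cauchy_convergent convergent_def by blast
  have "norm y \<le> 2 * (M + e) * norm x" if e: "e > 0" for e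
  proof (rule tendsto_upperbound[OF tendsto_norm[OF y]])
    show "\<forall>\<^sub>F k in sequentially. norm (poly_op (p k) T x) \<le> 2 * (M + e) * norm x"
      using uniform_limitD[OF p e]
    proof eventually_elim
      case (elim k)
      show ?case
      proof (rule bound)
        fix z assume z: "z \<in> K"
        have "cmod (poly (p k) z) \<le> cmod (f z) + cmod (poly (p k) z - f z)" by (rule norm_triangle_sub)
        also have "\<dots> \<le> M + e" using M[OF z] elim z by (intro add_mono) (auto simp: dist_norm intro: less_imp_le)
        finally show "cmod (poly (p k) z) \<le> M + e" .
      qed
    qed
  qed simp
  hence "((\<lambda>e. 2 * (M + e) * norm x) \<longlongrightarrow> 2 * (M + 0) * norm x) (at_right 0) \<Longrightarrow> norm y \<le> 2 * (M + 0) * norm x"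
    by (intro tendsto_lowerbound) (auto simp: eventually_at_filter)
  moreover have "((\<lambda>e. 2 * (M + e) * norm x) \<longlongrightarrow> 2 * (M + 0) * norm x) (at_right 0)"
    by (intro tendsto_intros)
  ultimately have "norm y \<le> 2 * M * norm x" by simp
  thus ?thesis using fun_op_eqI[OF p y null] by simp
qed

text \<open>Polynomials can compete with an extremal function only if the limit definition returns
  the ordinary value. The constant sequence gives it, and \<open>poly_op_tendsto_0\<close> gives
  uniqueness.\<close>

lemma fun_op_poly: "fun_op (numerical_range A) (poly p) ((*v) A) = poly_op p ((*v) A)"
proof
  fix x
  show "fun_op (numerical_range A) (poly p) ((*v) A) x = poly_op p ((*v) A) x"
  proof (rule fun_op_eqI)
    show "uniform_limit (numerical_range A) (\<lambda>k. poly p) (poly p) sequentially"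
      by (rule uniform_limit_const)
    show "(\<lambda>k. poly_op (q k) ((*v) A) x) \<longlonglongrightarrow> 0"
      if "uniform_limit (numerical_range A) (\<lambda>k. poly (q k)) (\<lambda>_. 0) sequentially" for q
      using poly_op_tendsto_0[OF clinear_matrix _ that] by (auto simp: mem_numerical_range)
  qed simp
qed

section \<open>From an extremal function to all polynomials\<close>

lemma SUP_cmod_numerical_range:
  assumes "continuous_on (numerical_range A) f" "z \<in> numerical_range A"
  shows "cmod (f z) \<le> (SUP z\<in>numerical_range A. cmod (f z))"
proof (rule cSUP_upper[OF assms(2)])
  show "bdd_above ((\<lambda>z. cmod (f z)) ` numerical_range A)"
    by (intro bounded_imp_bdd_above compact_imp_bounded compact_continuous_image
        continuous_intros assms compact_numerical_range)
qed

lemma poly_in_analytic_algebra: "poly p \<in> analytic_algebra K"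
  by (auto simp: analytic_algebra_def analytic_on_open intro!: continuous_intros holomorphic_intros)

lemma satisfies_crouzeix_if_extremal_le_2:
  assumes f: "extremal_function A f"
    and le: "onorm (fun_op (numerical_range A) f ((*v) A)) \<le> 2 * (SUP z\<in>numerical_range A. cmod (f z))"
  shows "satisfies_crouzeix A"
  unfolding satisfies_crouzeix_def
proof
  fix p
  let ?S = "\<lambda>g. SUP z\<in>numerical_range A. cmod (g z)"
  have pos: "?S g > 0" if "continuous_on (numerical_range A) g" "z \<in> numerical_range A" "g z \<noteq> 0" for g z
    using SUP_cmod_numerical_range[OF that(1,2)] that(3) by (meson less_le_trans zero_less_norm_iff)
  have fin: "f \<in> analytic_algebra (numerical_range A)" "\<exists>z\<in>numerical_range A. f z \<noteq> 0"
    using f by (auto simp: extremal_function_def is_arg_max_def)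
  hence "?S f > 0" using pos by (auto simp: analytic_algebra_def)
  hence ratio: "crouzeix_ratio A f \<le> 2" using le by (simp add: crouzeix_ratio_def divide_le_eq)
  show "onorm (poly_op p ((*v) A)) \<le> 2 * ?S (poly p)"
  proof (cases "\<exists>z\<in>numerical_range A. poly p z \<noteq> 0")
    case True
    moreover have "continuous_on (numerical_range A) (poly p)" by (intro continuous_intros)
    ultimately have "?S (poly p) > 0" using pos by blast
    moreover have "crouzeix_ratio A (poly p) \<le> crouzeix_ratio A f"
      using f True poly_in_analytic_algebra[of p] unfolding extremal_function_def is_arg_max_def
      by (meson not_le)
    hence "crouzeix_ratio A (poly p) \<le> 2" using ratio by simp
    ultimately show ?thesis by (simp add: crouzeix_ratio_def fun_op_poly divide_le_eq)
  next
    case False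
    \<comment> \<open>A polynomial vanishing on the numerical range is no competitor for the
      maximum, but its constant sequence is null, so its value at \<open>A\<close> is 0.\<close>
    have "poly_op p ((*v) A) x = 0" for x
    proof (rule LIMSEQ_unique[OF tendsto_const])
      have "uniform_limit (numerical_range A) (\<lambda>k. poly p) (\<lambda>_. 0) sequentially"
        using False by (intro uniform_limitI) auto
      thus "(\<lambda>k::nat. poly_op p ((*v) A) x) \<longlonglongrightarrow> 0"
        using poly_op_tendsto_0[OF clinear_matrix, of A "numerical_range A" "\<lambda>_. p" x]
        by (auto simp: mem_numerical_range)
    qed
    hence "onorm (poly_op p ((*v) A)) = 0" by (simp add: onorm_def)
    moreover have "?S (poly p) = 0"
      using False numerical_range_nonempty[of A] by (simp cong: SUP_cong_simp)
    ultimately show ?thesis by simp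
  qed
qed

section \<open>Cyclic subspaces and the three statements\<close>

lemma cyclic_subspace:
  fixes A :: "complex^'n^'n"
  shows subspace_cyclic_subspace: "vec.subspace (cyclic_subspace A x)"
    and cyclic_subspace_invariant: "(*v) A ` cyclic_subspace A x \<subseteq> cyclic_subspace A x"
    and cyclic_subspace_generator: "x \<in> cyclic_subspace A x"
proof -
  let ?S = "range (\<lambda>k. (((*v) A) ^^ k) x)"
  show "vec.subspace (cyclic_subspace A x)" unfolding cyclic_subspace_def by (rule vec.subspace_span)
  have "(*v) A ` vec.span ?S = vec.span ((*v) A ` ?S)"
    by (simp add: vec.linear_span_image[OF clinear_matrix])
  also have "\<dots> \<subseteq> vec.span ?S"
  proof (rule vec.span_mono)
    show "(*v) A ` ?S \<subseteq> ?S" by (auto intro!: image_eqI[of _ _ "Suc _"])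
  qed
  finally show "(*v) A ` cyclic_subspace A x \<subseteq> cyclic_subspace A x" unfolding cyclic_subspace_def .
  have "((*v) A ^^ 0) x \<in> ?S" by (rule rangeI)
  thus "x \<in> cyclic_subspace A x" unfolding cyclic_subspace_def by (auto intro: vec.span_base)
qed

theorem theorem3p1:
  fixes A :: "complex^'n^'n" and V :: "(complex^'n) set"
  assumes "vec.subspace V" and "vec.dim V \<le> 2"
  shows
    "(\<forall>f. extremal_function A f \<and>
          onorm (fun_op (numerical_range A) f ((*v) A)) =
            onorm_on V (fun_op (numerical_range A) f (compression A V))
          \<longrightarrow> satisfies_crouzeix A) \<and>
     (\<forall>x. extremal_vector A x \<and> vec.dim (cyclic_subspace A x) \<in> {1, 2}
          \<longrightarrow> satisfies_crouzeix A) \<and>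
     (CARD('n) = 3 \<longrightarrow>
        (\<forall>x. extremal_vector A x \<and> \<not> cyclic_vector A x \<longrightarrow> satisfies_crouzeix A) \<and>
        (\<not> cyclic_matrix A \<longrightarrow> satisfies_crouzeix A))"
proof -
  define K where "K = numerical_range A"
  have K: "compact K" "convex K" "K \<noteq> {}"
    unfolding K_def by (rule compact_numerical_range Toeplitz_Hausdorff numerical_range_nonempty)+
  have S: "cmod (f z) \<le> (SUP z\<in>K. cmod (f z))" if "f \<in> analytic_algebra K" "z \<in> K" for f z
    using that SUP_cmod_numerical_range unfolding K_def analytic_algebra_def by blast
  have ext: "f \<in> analytic_algebra K" if "extremal_function A f" for f
    using that by (auto simp: extremal_function_def is_arg_max_def K_def)
  have AK: "cinner (A *v x) x \<in> K" if "norm x = 1" for x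
    using that unfolding K_def mem_numerical_range by blast

  have a: "satisfies_crouzeix A"
    if f: "extremal_function A f" and eq: "onorm (fun_op K f ((*v) A)) = onorm_on V (fun_op K f (compression A V))"
    for f
  proof (rule satisfies_crouzeix_if_extremal_le_2[OF f])
    have "norm (fun_op K f (compression A V) x) \<le> 2 * (SUP z\<in>K. cmod (f z)) * norm x" if "x \<in> V" for x
    proof (rule fun_op_norm_le[OF clinear_compression[OF assms(1)] assms(1) _ assms(2) _ K ext[OF f] S[OF ext[OF f]] that])
      show "compression A V ` V \<subseteq> V" using orth_proj_in[OF assms(1)] by (auto simp: compression_def)
      show "cinner (compression A V x) x \<in> K" if "x \<in> V" "norm x = 1" for x
        unfolding K_def using compression_numerical_range[OF assms(1) that] .
    qed
    \<comment> \<open>At x = 0 the quotient in \<open>onorm_on\<close> is 0 by the convention on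
      division, so the bound must be nonnegative.\<close>
    moreover have "0 \<le> (SUP z\<in>K. cmod (f z))" using K(3) S[OF ext[OF f]] norm_ge_zero order_trans by blast
    ultimately have "norm (fun_op K f (compression A V) x) / norm x \<le> 2 * (SUP z\<in>K. cmod (f z))" if "x \<in> V" for x
      using that by (cases "x = 0") (auto simp: divide_le_eq)
    hence "onorm_on V (fun_op K f (compression A V)) \<le> 2 * (SUP z\<in>K. cmod (f z))"
      unfolding onorm_on_def using vec.subspace_0[OF assms(1)] by (intro cSUP_least) auto
    thus "onorm (fun_op (numerical_range A) f ((*v) A)) \<le> 2 * (SUP z\<in>numerical_range A. cmod (f z))"
      using eq by (simp add: K_def)
  qed

  have b: "satisfies_crouzeix A" if x: "extremal_vector A x" and dim: "vec.dim (cyclic_subspace A x) \<le> 2" for x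
  proof -
    obtain f where f: "extremal_function A f" and x0: "x \<noteq> 0"
      and eq: "norm (fun_op K f ((*v) A) x) = onorm (fun_op K f ((*v) A)) * norm x"
      using x unfolding extremal_vector_def K_def by blast
    have "norm (fun_op K f ((*v) A) x) \<le> 2 * (SUP z\<in>K. cmod (f z)) * norm x"
      by (rule fun_op_norm_le[OF clinear_matrix subspace_cyclic_subspace cyclic_subspace_invariant dim _ K
            ext[OF f] S[OF ext[OF f]] cyclic_subspace_generator]) (auto intro: AK)
    hence "onorm (fun_op K f ((*v) A)) \<le> 2 * (SUP z\<in>K. cmod (f z))"
      using x0 unfolding eq by simp
    thus ?thesis using satisfies_crouzeix_if_extremal_le_2[OF f] by (simp add: K_def)
  qed

  have c: "vec.dim (cyclic_subspace A x) \<le> 2" if "CARD('n) = 3" "\<not> cyclic_vector A x" for x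
  proof (rule ccontr)
    assume "\<not> vec.dim (cyclic_subspace A x) \<le> 2"
    moreover have "vec.dim (cyclic_subspace A x) \<le> vec.dim (UNIV :: (complex^'n) set)"
      by (rule vec.dim_subset) simp
    ultimately have "vec.dim (cyclic_subspace A x) = vec.dim (UNIV :: (complex^'n) set)"
      using that(1) by (simp add: card_cart_basis)
    hence "cyclic_subspace A x = UNIV"
      by (intro vec.subspace_dim_equal subspace_cyclic_subspace vec.subspace_UNIV) auto
    thus False using that(2) by (simp add: cyclic_vector_def)
  qed

  \<comment> \<open>Every vector generates a cyclic space of dimension at most two, so the
    polynomial bound holds at each vector and passes directly to the operator norm.\<close>
  have d: "satisfies_crouzeix A" if "CARD('n) = 3" "\<not> cyclic_matrix A"
    unfolding satisfies_crouzeix_def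
  proof
    fix p
    have p: "cmod (poly p z) \<le> (SUP z\<in>K. cmod (poly p z))" if "z \<in> K" for z
      using S[OF poly_in_analytic_algebra that] .
    have "norm (poly_op p ((*v) A) x) \<le> 2 * (SUP z\<in>K. cmod (poly p z)) * norm x" for x
    proof -
      have "vec.dim (cyclic_subspace A x) \<le> 2" using that c by (simp add: cyclic_matrix_def)
      thus ?thesis
        by (rule crouzeix_dim_le_2[OF clinear_matrix subspace_cyclic_subspace cyclic_subspace_invariant _ AK p
              cyclic_subspace_generator])
    qed
    thus "onorm (poly_op p ((*v) A)) \<le> 2 * (SUP z\<in>numerical_range A. cmod (poly p z))"
      unfolding K_def by (rule onorm_le)
  qed

  show ?thesis using a b c d unfolding K_def by auto
qed

end
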